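(* Let $L,C\ge1$, $\theta>0$, $0<c<1$, $\alpha\ge1$. There is a number $\hat C=\hat C(L,C,\theta,c,\alpha)$ such that the following holds. Let $a_1,\ldots,a_m\in\mathbb{R}^n$ be nonzero vectors spanning $\mathbb{R}^n$, and let $h_1,\ldots,h_m:\mathbb{R}\to\mathbb{R}_+$ satisfy (H1)–(H5) below; set $f_i:=h_i^2$ and $F(x):=\sum_{i=1}^mh_i(\langle a_i,x\rangle)^2$. Let $\mathcal{J}\subseteq\mathbb{Z}$ be a set of consecutive integers with a largest element, $\ell:=\max\mathcal{J}+1$, and let $\{w^{(j)}:j\in\mathcal{J}\}$ be an $\alpha$-approximate weight scheme for $\{f_i\},\{a_i\}$. Then \[ \log\mathcal{N}(B_F(2^\ell),\mathsf K_j)\le\hat C\,2^{\ell-j}\log m\qquad\text{for all }j\in\mathcal{J}. \]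
   Context: Conditions on $h_i$ (for all $x,y\in\mathbb{R}$, $\lambda\ge1$): (H1) $h_i(\lambda x)\ge c\,h_i(\pm x)$; (H2) $|h_i(x)-h_i(y)|\le L\,h_i(x-y)$; (H3) $h_i(\lambda x)\le C\lambda\,h_i(\pm x)$; (H4) $h_i(\lambda x)\ge c\lambda^\theta h_i(\pm x)$; (H5) $h_i(x\pm y)\le L(h_i(x)+h_i(y))$. For $w\in\mathbb{R}_+^m$, $M_w:=\sum_jw_ja_ja_j^\top$; $w$ is an $\alpha$-approximate weight at scale $s$ if $M_w$ is invertible, $w_i>0$, and $s/\alpha\le f_i(\|M_w^{-1/2}a_i\|_2)/(w_i\|M_w^{-1/2}a_i\|_2^2)\le\alpha s$ for all $i$. A family $\{w^{(j)}:j\in\mathcal{J}\}$ is an $\alpha$-approximate weight scheme if each $w^{(j)}$ is an $\alpha$-approximate weight at scale $2^j$ and $w_i^{(j+1)}\le\alpha w_i^{(j)}$ for all $i$ whenever $j,j+1\in\mathcal{J}$. Let $U_j:=M_{w^{(j)}}^{1/2}$, $B_F(s):=\{x:F(x)\le s\}$, and $\mathsf K_j:=\{x\in\mathbb{R}^n:h_i(\langle a_i,x\rangle)^2\le2^jw_i^{(j)}\|U_j^{-1}a_i\|_2^2\ \forall i\in[m]\}$ for $j\in\mathcal{J}$. For $S,S'\subseteq\mathbb{R}^n$, $\mathcal{N}(S,S')$ is the smallest number of translates of $S'$ needed to cover $S$.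
   Formalization: The formal theorem assumes m ≥ 2: for m = n = 1 the claim is false, since log m = 0 while e.g. h(x) = |x|, a_1 = 1, w^(j) = 2^(-j) needs at least two translates of K_j to cover B_F(2^ℓ). *)

theory Defs
  imports
    Complex_Main
    "HOL-Library.Extended_Nat"
    "Jordan_Normal_Form.Matrix"
    "Jordan_Normal_Form.VS_Connect"
    "Jordan_Normal_Form.Gauss_Jordan_Elimination"
begin

text \<open>The dimension \<open>n\<close> is a natural number and not an index type, because the
  constant in the theorem is chosen before \<open>n\<close> and \<open>m\<close> and must not depend on either.
  Hence \<open>\<real>\<^sup>n\<close> is \<open>carrier_vec n\<close>, and a family indexed by \<open>{1,\<dots>,m}\<close> is a function on
  \<open>nat\<close> of which only the values at \<open>i < m\<close> matter.\<close>

definition l2_norm :: "real vec \<Rightarrow> real" where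
  "l2_norm v = sqrt (v \<bullet> v)"

definition spans :: "nat \<Rightarrow> real vec set \<Rightarrow> bool" where
  "spans n S \<longleftrightarrow>
     LinearCombinations.module.span class_ring (module_vec TYPE(real) n) S = carrier_vec n"

definition psd_mat :: "nat \<Rightarrow> real mat \<Rightarrow> bool" where
  "psd_mat n A \<longleftrightarrow> A \<in> carrier_mat n n \<and> transpose_mat A = A \<and>
     (\<forall>x\<in>carrier_vec n. 0 \<le> x \<bullet> (A *\<^sub>v x))"

text \<open>\<open>A\<^sup>1\<^sup>/\<^sup>2\<close>, the unique positive semidefinite square root. It is meaningful only for
  positive semidefinite \<open>A\<close>.\<close>

definition sqrt_mat :: "real mat \<Rightarrow> real mat" where
  "sqrt_mat A = (THE B. psd_mat (dim_row A) B \<and> B * B = A)"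

definition inv_mat :: "real mat \<Rightarrow> real mat" where
  "inv_mat A = the (mat_inverse A)"

text \<open>\<open>M\<^sub>w = \<Sum>\<^sub>j w\<^sub>j a\<^sub>j a\<^sub>j\<^sup>T\<close>, given by its entries.\<close>

definition weight_mat :: "nat \<Rightarrow> nat \<Rightarrow> (nat \<Rightarrow> real vec) \<Rightarrow> (nat \<Rightarrow> real) \<Rightarrow> real mat" where
  "weight_mat n m a w = mat n n (\<lambda>(r, s). \<Sum>j<m. w j * (a j $ r * a j $ s))"

definition approx_weight ::
  "nat \<Rightarrow> nat \<Rightarrow> (nat \<Rightarrow> real \<Rightarrow> real) \<Rightarrow> (nat \<Rightarrow> real vec) \<Rightarrow> real \<Rightarrow> real \<Rightarrow> (nat \<Rightarrow> real) \<Rightarrow> bool"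
where
  "approx_weight n m f a \<alpha> s w \<longleftrightarrow>
     invertible_mat (weight_mat n m a w) \<and>
     (\<forall>i<m. 0 < w i \<and>
        (let r = l2_norm (inv_mat (sqrt_mat (weight_mat n m a w)) *\<^sub>v a i)
         in s / \<alpha> \<le> f i r / (w i * r\<^sup>2) \<and> f i r / (w i * r\<^sup>2) \<le> \<alpha> * s))"

definition approx_weight_scheme ::
  "nat \<Rightarrow> nat \<Rightarrow> (nat \<Rightarrow> real \<Rightarrow> real) \<Rightarrow> (nat \<Rightarrow> real vec) \<Rightarrow> real \<Rightarrow> int set \<Rightarrow>
   (int \<Rightarrow> nat \<Rightarrow> real) \<Rightarrow> bool"
where
  "approx_weight_scheme n m f a \<alpha> J w \<longleftrightarrow>
     (\<forall>j\<in>J. approx_weight n m f a \<alpha> (2 powi j) (w j)) \<and>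
     (\<forall>j. j \<in> J \<and> j + 1 \<in> J \<longrightarrow> (\<forall>i<m. w (j + 1) i \<le> \<alpha> * w j i))"

text \<open>The conjuncts after nonnegativity are (H1) to (H5). A double sign stands for both
  choices of sign.\<close>

definition H_conditions ::
  "real \<Rightarrow> real \<Rightarrow> real \<Rightarrow> real \<Rightarrow> (real \<Rightarrow> real) \<Rightarrow> bool"
where
  "H_conditions L C \<theta> c h \<longleftrightarrow>
     (\<forall>x. 0 \<le> h x) \<and>
     (\<forall>x t. 1 \<le> t \<longrightarrow> h (t * x) \<ge> c * h x \<and> h (t * x) \<ge> c * h (- x)) \<and>
     (\<forall>x y. \<bar>h x - h y\<bar> \<le> L * h (x - y)) \<and>
     (\<forall>x t. 1 \<le> t \<longrightarrow> h (t * x) \<le> C * t * h x \<and> h (t * x) \<le> C * t * h (- x)) \<and>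
     (\<forall>x t. 1 \<le> t \<longrightarrow>
        h (t * x) \<ge> c * t powr \<theta> * h x \<and> h (t * x) \<ge> c * t powr \<theta> * h (- x)) \<and>
     (\<forall>x y. h (x + y) \<le> L * (h x + h y) \<and> h (x - y) \<le> L * (h x + h y))"

definition F_sum :: "nat \<Rightarrow> (nat \<Rightarrow> real \<Rightarrow> real) \<Rightarrow> (nat \<Rightarrow> real vec) \<Rightarrow> real vec \<Rightarrow> real" where
  "F_sum m h a x = (\<Sum>i<m. (h i (a i \<bullet> x))\<^sup>2)"

definition B_set :: "nat \<Rightarrow> (real vec \<Rightarrow> real) \<Rightarrow> real \<Rightarrow> real vec set" where
  "B_set n F s = {x \<in> carrier_vec n. F x \<le> s}"

definition K_set ::
  "nat \<Rightarrow> nat \<Rightarrow> (nat \<Rightarrow> real \<Rightarrow> real) \<Rightarrow> (nat \<Rightarrow> real vec) \<Rightarrow> (int \<Rightarrow> nat \<Rightarrow> real) \<Rightarrow> int \<Rightarrow> real vec set"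
where
  "K_set n m h a w j =
     (let U = sqrt_mat (weight_mat n m a (w j))
      in {x \<in> carrier_vec n. \<forall>i<m.
            (h i (a i \<bullet> x))\<^sup>2 \<le> 2 powi j * w j i * (l2_norm (inv_mat U *\<^sub>v a i))\<^sup>2})"

text \<open>The value is \<open>\<infinity>\<close> if no finite number of translates suffices.\<close>

definition covering_number :: "nat \<Rightarrow> real vec set \<Rightarrow> real vec set \<Rightarrow> enat" where
  "covering_number n S S' =
     Inf {enat (card T) | T. finite T \<and> T \<subseteq> carrier_vec n \<and>
            S \<subseteq> (\<Union>t\<in>T. (\<lambda>y. t + y) ` S')}"

end

theory Submission
  imports
    Defs
    "Jordan_Normal_Form.Char_Poly"
    "HOL-Computational_Algebra.Fundamental_Theorem_Algebra"
begin

text \<open>Fix \<open>j\<close> and put \<open>U = M\<^sub>w\<^sup>1\<^sup>/\<^sup>2\<close>, \<open>r\<^sub>i = \<parallel>U\<^sup>-\<^sup>1 a\<^sub>i\<parallel>\<close>. By (H4), \<open>\<K>\<^sub>j\<close> contains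
  \<open>{x. \<forall>i. \<bar>\<langle>a\<^sub>i, x\<rangle>\<bar> \<le> \<rho> r\<^sub>i}\<close> for some constant \<open>\<rho>\<close>, so it suffices to cut \<open>B\<^sub>F(2\<^sup>l)\<close> into pieces
  of oscillation at most \<open>\<rho>\<close> in the norm \<open>max\<^sub>i \<bar>\<langle>a\<^sub>i, x\<rangle>\<bar> / r\<^sub>i\<close>. By (H3), (H4) and (H5), a difference \<open>z\<close> of two
  points of the ball whose norm is at most \<open>u \<ge> 1\<close> satisfies
  \<open>\<parallel>U z\<parallel>\<^sup>2 = (\<Sum>\<^sub>i w\<^sub>i \<langle>a\<^sub>i, z\<rangle>\<^sup>2) \<le> Q u\<^bsup>2-2\<theta>\<^esup>\<close> with \<open>Q\<close> of order \<open>2\<^bsup>l-j\<^esup>\<close>. Since the norm of \<open>z\<close> is at most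
  \<open>\<parallel>U z\<parallel>\<close>, the oscillation of the whole ball is at most \<open>Q\<^bsup>1/2\<theta>\<^esup>\<close>, and by the dual Sudakov inequality it
  can be halved at a cost of order \<open>Q u\<^bsup>-2\<theta>\<^esup> log m\<close> in the logarithm of the number of pieces. The
  costs form a geometric series with sum of order \<open>Q log m\<close>.\<close>

section \<open>Polynomials evaluated at matrices\<close>

text \<open>Horner's scheme, so that the ring laws below follow by induction on
  \<open>pCons\<close>. The size of the identity is read off \<open>A\<close>; the laws hold for
  square \<open>A\<close>.\<close>

definition mat_poly :: "'a::comm_ring_1 mat \<Rightarrow> 'a poly \<Rightarrow> 'a mat" where
  "mat_poly A p = fold_coeffs (\<lambda>c B. c \<cdot>\<^sub>m 1\<^sub>m (dim_row A) + A * B) p (0\<^sub>m (dim_row A) (dim_row A))"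

context
  fixes A :: "'a::comm_ring_1 mat" and n :: nat
  assumes A: "A \<in> carrier_mat n n"
begin

lemma mat_poly_0: "mat_poly A 0 = 0\<^sub>m n n"
  using A by (simp add: mat_poly_def)

lemma mat_poly_pCons: "mat_poly A (pCons c p) = c \<cdot>\<^sub>m 1\<^sub>m n + A * mat_poly A p"
\<comment> \<open>\<open>fold_coeffs\<close> does not unfold at \<open>pCons 0 0\<close>, which is
  the zero polynomial; there both sides are zero.\<close>
proof (cases "c = 0 \<and> p = 0")
  case True
  have "(0::'a) \<cdot>\<^sub>m 1\<^sub>m n = 0\<^sub>m n n" by (rule eq_matI) auto
  then show ?thesis using A True by (simp add: mat_poly_def)
next
  case False
  then show ?thesis using A by (auto simp: mat_poly_def)
qed

lemma mat_poly_carrier [simp]: "mat_poly A p \<in> carrier_mat n n"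
  by (induction p) (use A in \<open>auto simp: mat_poly_0 mat_poly_pCons\<close>)

lemma mat_poly_dim [simp]: "dim_row (mat_poly A p) = n" "dim_col (mat_poly A p) = n"
  by (rule carrier_matD[OF mat_poly_carrier])+

lemma mat_poly_const: "mat_poly A [:c:] = c \<cdot>\<^sub>m 1\<^sub>m n"
  using A by (simp add: mat_poly_pCons mat_poly_0)

lemma mat_poly_1: "mat_poly A 1 = 1\<^sub>m n"
proof -
  have "(1::'a) \<cdot>\<^sub>m 1\<^sub>m n = 1\<^sub>m n" by (rule eq_matI) auto
  then show ?thesis by (simp add: one_pCons mat_poly_const)
qed

lemma mat_poly_add: "mat_poly A (p + q) = mat_poly A p + mat_poly A q"
proof (induction p arbitrary: q)
  case 0
  then show ?case by (simp add: mat_poly_0)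
next
  case (pCons c p)
  show ?case
  proof (cases q)
    case (pCons d r)
    have "mat_poly A (pCons c p + q) = (c + d) \<cdot>\<^sub>m 1\<^sub>m n + A * (mat_poly A p + mat_poly A r)"
      by (simp add: pCons mat_poly_pCons pCons.IH)
    also have "A * (mat_poly A p + mat_poly A r) = A * mat_poly A p + A * mat_poly A r"
      by (rule mult_add_distrib_mat[OF A]) auto
    also have "(c + d) \<cdot>\<^sub>m 1\<^sub>m n = c \<cdot>\<^sub>m 1\<^sub>m n + d \<cdot>\<^sub>m 1\<^sub>m n"
      by (rule add_smult_distrib_right_mat) auto
    finally show ?thesis
      using A by (auto simp: pCons mat_poly_pCons intro!: eq_matI)
  qed
qed

lemma mat_poly_smult: "mat_poly A (smult c p) = c \<cdot>\<^sub>m mat_poly A p"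
proof (induction p)
  case 0
  show ?case by (auto simp: mat_poly_0)
next
  case (pCons d p)
  have "A * (c \<cdot>\<^sub>m mat_poly A p) = c \<cdot>\<^sub>m (A * mat_poly A p)"
    by (rule mult_smult_distrib[OF A mat_poly_carrier])
  then show ?case using A
    by (auto simp: mat_poly_pCons pCons.IH algebra_simps intro!: eq_matI)
qed

lemma mat_poly_mult: "mat_poly A (p * q) = mat_poly A p * mat_poly A q"
proof (induction p)
  case 0
  show ?case by (simp add: mat_poly_0 left_mult_zero_mat[OF mat_poly_carrier])
next
  case (pCons c p)
  have "mat_poly A (pCons c p * q) = c \<cdot>\<^sub>m mat_poly A q + mat_poly A (pCons 0 (p * q))"
    by (simp add: mult_pCons_left mat_poly_add mat_poly_smult)
  also have "mat_poly A (pCons 0 (p * q)) = A * mat_poly A (p * q)"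
    using A by (simp add: mat_poly_pCons) (auto intro!: eq_matI)
  also have "\<dots> = (A * mat_poly A p) * mat_poly A q"
    unfolding pCons.IH by (rule assoc_mult_mat[symmetric, OF A mat_poly_carrier mat_poly_carrier])
  also have "c \<cdot>\<^sub>m mat_poly A q + \<dots> = (c \<cdot>\<^sub>m 1\<^sub>m n + A * mat_poly A p) * mat_poly A q"
    by (subst add_mult_distrib_mat[where n = n and nr = n and nc = n])
      (use A in \<open>auto simp: mult_smult_assoc_mat[OF one_carrier_mat mat_poly_carrier]
        left_mult_one_mat[OF mat_poly_carrier]\<close>)
  finally show ?case by (simp add: mat_poly_pCons)
qed

text \<open>Applied with \<open>B = A\<close> for transposition, and with \<open>B\<close> an
  arbitrary square root of \<open>A\<close> in the uniqueness proof.\<close>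

lemma mat_poly_commute:
  assumes B: "B \<in> carrier_mat n n" and comm: "B * A = A * B"
  shows "B * mat_poly A p = mat_poly A p * B"
proof (induction p)
  case 0
  show ?case using B by (simp add: mat_poly_0)
next
  case (pCons c p)
  have "B * mat_poly A (pCons c p) = B * (c \<cdot>\<^sub>m 1\<^sub>m n) + B * (A * mat_poly A p)"
    unfolding mat_poly_pCons by (rule mult_add_distrib_mat[OF B]) (use A in auto)
  also have "B * (A * mat_poly A p) = A * B * mat_poly A p"
    using assoc_mult_mat[OF B A mat_poly_carrier[of p]] comm by simp
  also have "\<dots> = A * (mat_poly A p * B)"
    using assoc_mult_mat[OF A B mat_poly_carrier] pCons.IH by simp
  also have "\<dots> = (A * mat_poly A p) * B"
    using assoc_mult_mat[OF A mat_poly_carrier B] by simp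
  also have "B * (c \<cdot>\<^sub>m 1\<^sub>m n) = (c \<cdot>\<^sub>m 1\<^sub>m n) * B"
    by (simp add: mult_smult_distrib[OF B one_carrier_mat]
        mult_smult_assoc_mat[OF one_carrier_mat B] left_mult_one_mat[OF B] right_mult_one_mat[OF B])
  also have "(c \<cdot>\<^sub>m 1\<^sub>m n) * B + (A * mat_poly A p) * B = mat_poly A (pCons c p) * B"
    unfolding mat_poly_pCons by (rule add_mult_distrib_mat[symmetric]) (use A B in auto)
  finally show ?case .
qed

text \<open>Transposition reverses the product in each Horner step, and commutation with
  \<open>A\<close> restores the order.\<close>

lemma mat_poly_transpose:
  assumes sym: "transpose_mat A = A"
  shows "transpose_mat (mat_poly A p) = mat_poly A p"
proof (induction p)
  case 0
  show ?case by (simp add: mat_poly_0)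
next
  case (pCons c p)
  have "transpose_mat (mat_poly A (pCons c p)) = c \<cdot>\<^sub>m 1\<^sub>m n + transpose_mat (A * mat_poly A p)"
    unfolding mat_poly_pCons using A
    by (subst transpose_add[of _ n n]) (auto intro!: eq_matI)
  also have "transpose_mat (A * mat_poly A p) = mat_poly A p * A"
    using transpose_mult[OF A mat_poly_carrier[of p]] sym pCons.IH by simp
  also have "\<dots> = A * mat_poly A p"
    using mat_poly_commute[OF A refl] by simp
  finally show ?case by (simp add: mat_poly_pCons)
qed

lemma mat_poly_vec_pCons:
  assumes v: "v \<in> carrier_vec n"
  shows "mat_poly A (pCons c p) *\<^sub>v v = c \<cdot>\<^sub>v v + A *\<^sub>v (mat_poly A p *\<^sub>v v)"
proof -
  have "mat_poly A (pCons c p) *\<^sub>v v = (c \<cdot>\<^sub>m 1\<^sub>m n) *\<^sub>v v + (A * mat_poly A p) *\<^sub>v v"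
    unfolding mat_poly_pCons by (rule add_mult_distrib_mat_vec[OF _ _ v]) (use A in auto)
  also have "(c \<cdot>\<^sub>m 1\<^sub>m n) *\<^sub>v v = c \<cdot>\<^sub>v v"
    using v by (intro eq_vecI) auto
  also have "(A * mat_poly A p) *\<^sub>v v = A *\<^sub>v (mat_poly A p *\<^sub>v v)"
    by (rule assoc_mult_mat_vec[OF A mat_poly_carrier v])
  finally show ?thesis .
qed

text \<open>Shows that the entries are linear in the coefficients, which turns the search for an
  annihilator into a linear system.\<close>

lemma mat_poly_sum_coeffs:
  assumes "r < n" "s < n"
  shows "mat_poly A p $$ (r, s) = (\<Sum>k\<le>degree p. coeff p k * (A ^\<^sub>m k) $$ (r, s))"
proof -
  \<comment> \<open>The row \<open>r\<close> is generalised because multiplication by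
    \<open>A\<close> from the left mixes the rows, and the upper limit \<open>N\<close> because the
    degree changes along the induction. The column \<open>s\<close> stays fixed.\<close>
  have "mat_poly A p $$ (r, s) = (\<Sum>k\<le>N. coeff p k * (A ^\<^sub>m k) $$ (r, s))" 
    if "degree p \<le> N" "r < n" for p N r
    using that
  proof (induction p arbitrary: N r)
    case 0
    then show ?case using assms by (simp add: mat_poly_0)
  next
    case (pCons c p)
    have pw: "A ^\<^sub>m k \<in> carrier_mat n n" for k using A by (rule pow_carrier_mat)
    have pow: "(A ^\<^sub>m Suc k) $$ (r, s) = (\<Sum>i<n. A $$ (r, i) * (A ^\<^sub>m k) $$ (i, s))" for k
    proof -
      \<comment> \<open>The power recursion multiplies by \<open>A\<close> from the right, Horner's
        scheme from the left.\<close>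
      have "A ^\<^sub>m Suc k = A * A ^\<^sub>m k"
        by (induction k) (use A in \<open>simp_all add: assoc_mult_mat[OF A pw A]\<close>)
      then show ?thesis using A pw[of k] pCons.prems(2) assms(2)
        by (simp add: scalar_prod_def atLeast0LessThan)
    qed
    show ?case
    proof (cases "p = 0")
      case True
      have "(\<Sum>k\<le>N. coeff [:c:] k * (A ^\<^sub>m k) $$ (r, s)) = (\<Sum>k\<in>{0}. coeff [:c:] k * (A ^\<^sub>m k) $$ (r, s))"
        by (rule sum.mono_neutral_right) (auto simp: coeff_pCons split: nat.splits)
      then show ?thesis using True A pCons.prems(2) assms by (simp add: mat_poly_const)
    next
      case False
      then obtain N' where N: "N = Suc N'" "degree p \<le> N'"
        using pCons.prems by (cases N) auto
      have "mat_poly A (pCons c p) $$ (r, s) = c * (1\<^sub>m n $$ (r, s)) + (A * mat_poly A p) $$ (r, s)"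
        unfolding mat_poly_pCons using A pCons.prems(2) assms(2) by simp
      also have "(A * mat_poly A p) $$ (r, s) = (\<Sum>i<n. A $$ (r, i) * mat_poly A p $$ (i, s))"
        using A pCons.prems(2) assms(2) by (simp add: scalar_prod_def atLeast0LessThan)
      also have "\<dots> = (\<Sum>i<n. A $$ (r, i) * (\<Sum>k\<le>N'. coeff p k * (A ^\<^sub>m k) $$ (i, s)))"
        using pCons.IH N by auto
      also have "\<dots> = (\<Sum>k\<le>N'. coeff p k * (A ^\<^sub>m Suc k) $$ (r, s))"
        unfolding pow sum_distrib_left by (subst sum.swap) (simp add: mult_ac)
      finally show ?thesis
        using A by (simp add: N sum.atMost_Suc_shift del: sum.atMost_Suc pow_mat.simps(2))
    qed
  qed
  then show ?thesis using assms by blast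
qed

end

section \<open>A nonzero annihilating polynomial by a dimension count\<close>

lemma mat_poly_annihilator:
  fixes A :: "'a::field mat"
  assumes A: "A \<in> carrier_mat n n"
  obtains p where "p \<noteq> 0" "mat_poly A p = 0\<^sub>m n n"
proof -
  (* The n * n entries of the powers of A give a homogeneous system in n * n + 1 unknown
     coefficients; a zero row makes it square and singular. *)
  define N where "N = Suc (n * n)"
  define K where "K = mat N N (\<lambda>(r, k). if r < n * n then (A ^\<^sub>m k) $$ (r div n, r mod n) else 0)"
  have K: "K \<in> carrier_mat N N" by (simp add: K_def)
  \<comment> \<open>Multiplying the zero row by 0 changes nothing, yet multiplies the determinant by
    0.\<close>
  have "K = multrow (n * n) 0 K"
    by (rule eq_matI) (auto simp: K_def N_def)
  then have "det K = 0 * det K"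
    using det_multrow[OF _ K, of "n * n" 0] by (simp add: N_def)
  then obtain v where v: "v \<in> carrier_vec N" "v \<noteq> 0\<^sub>v N" "K *\<^sub>v v = 0\<^sub>v N"
    using det_0_iff_vec_prod_zero[OF K] by auto
  define p where "p = (\<Sum>k<N. monom (v $ k) k)"
  have coeff: "coeff p k = (if k < N then v $ k else 0)" for k
    by (simp add: p_def coeff_sum if_distrib cong: if_cong)
  have "p \<noteq> 0"
  proof
    assume "p = 0"
    then have "v $ k = 0" if "k < N" for k using coeff[of k] that by simp
    then have "v = 0\<^sub>v N" using v(1) by (intro eq_vecI) auto
    with v(2) show False ..
  qed
  moreover have "mat_poly A p = 0\<^sub>m n n"
  proof (rule eq_matI)
    fix r s assume "r < dim_row (0\<^sub>m n n :: 'a mat)" "s < dim_col (0\<^sub>m n n :: 'a mat)"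
    then have rs: "r < n" "s < n" by auto
    \<comment> \<open>Row \<open>r * n + s\<close> lies above the padding row and holds the (r, s)
      entries of the powers.\<close>
    then have lt: "r * n + s < n * n"
      by (metis add.commute add_less_cancel_left less_le_trans mult_Suc mult_le_mono1 Suc_leI)
    have deg: "degree p \<le> n * n"
      by (rule degree_le) (auto simp: coeff N_def)
    have "mat_poly A p $$ (r, s) = (\<Sum>k\<le>degree p. coeff p k * (A ^\<^sub>m k) $$ (r, s))"
      by (rule mat_poly_sum_coeffs[OF A rs])
    also have "\<dots> = (\<Sum>k<N. coeff p k * (A ^\<^sub>m k) $$ (r, s))"
      using deg by (intro sum.mono_neutral_left) (auto simp: N_def coeff_eq_0)
    also have "\<dots> = (K *\<^sub>v v) $ (r * n + s)"
      using lt rs v(1) K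
      by (auto simp: scalar_prod_def coeff K_def N_def atLeast0LessThan mult.commute intro!: sum.cong)
    also have "\<dots> = 0" using v(3) lt by (simp add: N_def)
    finally show "mat_poly A p $$ (r, s) = 0\<^sub>m n n $$ (r, s)" using rs by simp
  qed (use A in auto)
  ultimately show ?thesis using that by blast
qed

section \<open>Positive definite matrices and their square roots\<close>

text \<open>Every column of s(A) lies in the kernel of r(A), which is trivial. This strips injective
  factors from an annihilator.\<close>

lemma mat_poly_mult_eq_0_cancel:
  fixes A :: "'a::comm_ring_1 mat"
  assumes A: "A \<in> carrier_mat n n" and z: "mat_poly A (r * s) = 0\<^sub>m n n"
    and inj: "\<And>v. v \<in> carrier_vec n \<Longrightarrow> mat_poly A r *\<^sub>v v = 0\<^sub>v n \<Longrightarrow> v = 0\<^sub>v n"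
  shows "mat_poly A s = 0\<^sub>m n n"
proof (rule eq_matI)
  note [simp] = mat_poly_carrier[OF A] mat_poly_dim[OF A]
  fix i j assume "i < dim_row (0\<^sub>m n n :: 'a mat)" "j < dim_col (0\<^sub>m n n :: 'a mat)"
  then have ij: "i < n" "j < n" by auto
  have "mat_poly A r *\<^sub>v col (mat_poly A s) j = col (mat_poly A r * mat_poly A s) j"
    using ij by (intro eq_vecI) auto
  also have "\<dots> = 0\<^sub>v n"
    using z ij by (simp add: mat_poly_mult[OF A])
  finally have "col (mat_poly A s) j = 0\<^sub>v n"
    by (rule inj[rotated]) (simp add: carrier_vecI)
  then have "col (mat_poly A s) j $ i = 0" using ij by simp
  then show "mat_poly A s $$ (i, j) = 0\<^sub>m n n $$ (i, j)" using ij by simp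
qed (simp_all add: mat_poly_dim[OF A])

lemma symmetric_mat_scalar_prod:
  fixes A :: "'a::comm_ring_1 mat"
  assumes "A \<in> carrier_mat n n" "transpose_mat A = A" "x \<in> carrier_vec n" "y \<in> carrier_vec n"
  shows "(A *\<^sub>v x) \<bullet> y = x \<bullet> (A *\<^sub>v y)"
  using transpose_vec_mult_scalar[of A n n y x] assms by simp

lemma real_scalar_prod_self_eq_0:
  fixes v :: "real vec"
  assumes "v \<in> carrier_vec n" "v \<bullet> v = 0"
  shows "v = 0\<^sub>v n"
  proof (rule eq_vecI)
  fix i assume "i < dim_vec (0\<^sub>v n :: real vec)"
  then show "v $ i = 0\<^sub>v n $ i"
    using assms by (auto simp: scalar_prod_def sum_nonneg_eq_0_iff)
qed (use assms in simp)

lemma real_scalar_prod_self_ge_0: "0 \<le> v \<bullet> (v :: real vec)"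
  by (simp add: scalar_prod_def sum_nonneg)

lemma real_scalar_prod_self_pos:
  fixes v :: "real vec"
  assumes "v \<in> carrier_vec n" "v \<noteq> 0\<^sub>v n"
  shows "0 < v \<bullet> v"
  using real_scalar_prod_self_eq_0[OF assms(1)] real_scalar_prod_self_ge_0[of v] assms(2)
  by (cases "v \<bullet> v = 0") auto

text \<open>Splits according to whether a complex root is real. The quadratic factor is written as a
  square plus a positive constant because this form is visibly positive at a symmetric
  matrix.\<close>

lemma real_poly_complex_root:
  fixes p :: "real poly"
  assumes "degree p > 0"
  shows "(\<exists>x q. p = [:- x, 1:] * q) \<or> (\<exists>x y q. y \<noteq> 0 \<and> p = ([:- x, 1:] * [:- x, 1:] + [:y\<^sup>2:]) * q)"
proof -
  interpret h: map_poly_inj_idom_hom "of_real :: real \<Rightarrow> complex" ..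
  have "\<not> constant (poly (map_poly of_real p :: complex poly))"
    using assms by (simp add: constant_degree degree_map_poly)
  then obtain z where z: "poly (map_poly of_real p) z = (0::complex)"
    using fundamental_theorem_of_algebra by blast
  show ?thesis
  proof (cases "Im z = 0")
    case True
    then have "z = of_real (Re z)" by (simp add: complex_eq_iff)
    then have "poly p (Re z) = 0"
      using z of_real_hom.poly_map_poly[of p "Re z", where ?'a = complex] by simp
    then have "[:- Re z, 1:] dvd p" by (simp add: poly_eq_0_iff_dvd)
    then obtain q where "p = [:- Re z, 1:] * q" ..
    then show ?thesis by blast
  next
    case False
    define d where "d = [:- Re z, 1:] * [:- Re z, 1:] + [:(Im z)\<^sup>2:]"
    have d: "d = [:(Re z)\<^sup>2 + (Im z)\<^sup>2, - 2 * Re z, 1:]"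
      by (simp add: d_def power2_eq_square)
    then have "degree d = 2" by simp
    then have "degree (p mod d) < 2" using degree_mod_less[of d p] d by auto
    define r0 r1 where "r0 = coeff (p mod d) 0" and "r1 = coeff (p mod d) 1"
    have r: "p mod d = [:r0, r1:]"
      using \<open>degree (p mod d) < 2\<close>
      by (intro poly_eqI) (auto simp: r0_def r1_def coeff_pCons coeff_eq_0 split: nat.splits)
    have dz: "poly (map_poly of_real d) z = 0"
      unfolding d by (simp add: complex_eq_iff power2_eq_square map_poly_pCons algebra_simps)
    have "p = d * (p div d) + p mod d" by simp
    then have "poly (map_poly of_real p) z = poly (map_poly of_real (d * (p div d) + p mod d)) z"
      by simp
    \<comment> \<open>A real polynomial of degree at most one that vanishes at a nonreal point is
      zero, so \<open>d\<close> divides \<open>p\<close>.\<close>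
    then have "of_real r0 + of_real r1 * z = 0"
      unfolding z h.hom_add h.hom_mult r poly_add poly_mult dz by (simp add: hom_distribs mult.commute)
    then have "r1 * Im z = 0" "r0 + r1 * Re z = 0"
      by (auto simp: complex_eq_iff)
    then have "p mod d = 0" using False r by simp
    then have "p = d * (p div d)" by auto
    then show ?thesis using False unfolding d_def by blast
  qed
qed

section \<open>Annihilators of a positive definite matrix\<close>

lemma mat_poly_linear_vec:
  fixes A :: "'a::comm_ring_1 mat"
  assumes A: "A \<in> carrier_mat n n" and v: "v \<in> carrier_vec n"
  shows "mat_poly A [:- x, 1:] *\<^sub>v v = A *\<^sub>v v - x \<cdot>\<^sub>v v"
proof -
  have "mat_poly A [:1:] *\<^sub>v v = v"
    using mat_poly_1[OF A] v by (simp add: one_pCons)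
  then show ?thesis
    unfolding mat_poly_vec_pCons[OF A v, of "- x" "[:1:]"]
    using A v by (intro eq_vecI) auto
qed

text \<open>Definiteness is split into semidefiniteness and a trivial kernel: for a weight matrix
  the first comes from the weights, the second from invertibility.\<close>

locale pos_def_mat =
  fixes A :: "real mat" and n :: nat
  assumes carrier: "A \<in> carrier_mat n n" and sym: "transpose_mat A = A"
    and psd: "\<And>x. x \<in> carrier_vec n \<Longrightarrow> 0 \<le> x \<bullet> (A *\<^sub>v x)"
    and inj: "\<And>x. x \<in> carrier_vec n \<Longrightarrow> A *\<^sub>v x = 0\<^sub>v n \<Longrightarrow> x = 0\<^sub>v n"
begin

lemma mat_poly_scalar_prod:
  assumes "x \<in> carrier_vec n" "y \<in> carrier_vec n"
  shows "(mat_poly A p *\<^sub>v x) \<bullet> y = x \<bullet> (mat_poly A p *\<^sub>v y)"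
  using symmetric_mat_scalar_prod[OF mat_poly_carrier[OF carrier] mat_poly_transpose[OF carrier sym]] assms .

text \<open>One factor p(A) moves across the scalar product by symmetry. Hence squares of
  polynomials are positive semidefinite at \<open>A\<close>.\<close>

lemma mat_poly_square_vec:
  assumes v: "v \<in> carrier_vec n"
  shows "v \<bullet> (mat_poly A (p * p) *\<^sub>v v) = (mat_poly A p *\<^sub>v v) \<bullet> (mat_poly A p *\<^sub>v v)"
proof -
  have "mat_poly A (p * p) *\<^sub>v v = mat_poly A p *\<^sub>v (mat_poly A p *\<^sub>v v)"
    using assoc_mult_mat_vec[OF mat_poly_carrier[OF carrier] mat_poly_carrier[OF carrier] v]
    by (simp add: mat_poly_mult[OF carrier])
  then show ?thesis using v mult_mat_vec_carrier[OF mat_poly_carrier[OF carrier] v]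
    by (simp add: mat_poly_scalar_prod[symmetric])
qed

lemma mat_poly_square_vec_eq_0:
  assumes v: "v \<in> carrier_vec n" and "mat_poly A (p * p) *\<^sub>v v = 0\<^sub>v n"
  shows "mat_poly A p *\<^sub>v v = 0\<^sub>v n"
  using mat_poly_square_vec[OF v, of p] assms mult_mat_vec_carrier[OF mat_poly_carrier[OF carrier] v]
  by (auto intro!: real_scalar_prod_self_eq_0)

text \<open>A nonzero kernel vector would be an eigenvector with eigenvalue \<open>x\<close>.
  Semidefiniteness excludes \<open>x < 0\<close>, the trivial kernel excludes
  \<open>x = 0\<close>.\<close>

lemma linear_factor_inj:
  assumes v: "v \<in> carrier_vec n" and "x \<le> 0" and 0: "mat_poly A [:- x, 1:] *\<^sub>v v = 0\<^sub>v n"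
  shows "v = 0\<^sub>v n"
proof (rule ccontr)
  assume nz: "v \<noteq> 0\<^sub>v n"
  have Av: "A *\<^sub>v v \<in> carrier_vec n" using mult_mat_vec_carrier[OF carrier v] .
  have eq: "A *\<^sub>v v - x \<cdot>\<^sub>v v = 0\<^sub>v n" using 0 by (simp add: mat_poly_linear_vec[OF carrier v])
  have Avx: "A *\<^sub>v v = x \<cdot>\<^sub>v v"
  proof (rule eq_vecI)
    fix i assume "i < dim_vec (x \<cdot>\<^sub>v v)"
    then have i: "i < n" using v by simp
    then have "(A *\<^sub>v v - x \<cdot>\<^sub>v v) $ i = 0"
      by (simp add: eq)
    then show "(A *\<^sub>v v) $ i = (x \<cdot>\<^sub>v v) $ i" using i v by simp
  qed (use v carrier in simp)
  have "v \<bullet> (A *\<^sub>v v) = x * (v \<bullet> v)" unfolding Avx using v by simp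
  moreover have "x * (v \<bullet> v) < 0" if "x \<noteq> 0"
    using real_scalar_prod_self_pos[OF v nz] that \<open>x \<le> 0\<close> by (simp add: mult_neg_pos)
  ultimately have "x = 0" using psd[OF v] by (cases "x = 0") auto
  then have "A *\<^sub>v v = 0\<^sub>v n" using Avx v by (intro eq_vecI) auto
  then show False using inj[OF v] nz by blast
qed

text \<open>Pairing with \<open>v\<close> gives a nonnegative term from the square plus
  \<open>y\<^sup>2 * (v \<bullet> v)\<close>, which cannot vanish for nonzero
  \<open>v\<close>.\<close>

lemma quadratic_factor_inj:
  assumes v: "v \<in> carrier_vec n" and "y \<noteq> 0"
    and 0: "mat_poly A ([:- x, 1:] * [:- x, 1:] + [:y\<^sup>2:]) *\<^sub>v v = 0\<^sub>v n"
  shows "v = 0\<^sub>v n"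
proof (rule ccontr)
  assume nz: "v \<noteq> 0\<^sub>v n"
  define B where "B = mat_poly A ([:- x, 1:] * [:- x, 1:])"
  have B: "B \<in> carrier_mat n n" unfolding B_def by (rule mat_poly_carrier[OF carrier])
  have c1: "mat_poly A [:y\<^sup>2:] *\<^sub>v v = y\<^sup>2 \<cdot>\<^sub>v v"
    unfolding mat_poly_const[OF carrier] using v by (intro eq_vecI) auto
  have "mat_poly A ([:- x, 1:] * [:- x, 1:] + [:y\<^sup>2:]) *\<^sub>v v = B *\<^sub>v v + y\<^sup>2 \<cdot>\<^sub>v v"
    unfolding mat_poly_add[OF carrier] B_def[symmetric] c1[symmetric]
    by (rule add_mult_distrib_mat_vec[OF B mat_poly_carrier[OF carrier] v])
  then have "0 = v \<bullet> (B *\<^sub>v v + y\<^sup>2 \<cdot>\<^sub>v v)" using 0 v by simp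
  also have "\<dots> = v \<bullet> (B *\<^sub>v v) + y\<^sup>2 * (v \<bullet> v)"
    using mult_mat_vec_carrier[OF B v] v by (subst scalar_prod_add_distrib[of _ n]) auto
  finally have "0 = v \<bullet> (B *\<^sub>v v) + y\<^sup>2 * (v \<bullet> v)" .
  moreover have "0 \<le> v \<bullet> (B *\<^sub>v v)"
    unfolding B_def mat_poly_square_vec[OF v] by (rule real_scalar_prod_self_ge_0)
  moreover have "0 < y\<^sup>2 * (v \<bullet> v)" using real_scalar_prod_self_pos[OF v nz] \<open>y \<noteq> 0\<close> by simp
  ultimately show False by linarith
qed

text \<open>A factor of \<open>p\<close> with a root that is not a positive real is injective at \<open>A\<close>, and a repeated
  linear factor may be dropped because \<open>B\<^sup>2 v = 0\<close> implies \<open>B v = 0\<close> for symmetric \<open>B\<close>.\<close>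

lemma annihilator_reduce:
  assumes "p \<noteq> 0" "finite \<Lambda>" "\<forall>x\<in>\<Lambda>. 0 < x" "mat_poly A (p * (\<Prod>x\<in>\<Lambda>. [:- x, 1:])) = 0\<^sub>m n n"
  shows "\<exists>\<Lambda>. finite \<Lambda> \<and> (\<forall>x\<in>\<Lambda>. 0 < x) \<and> mat_poly A (\<Prod>x\<in>\<Lambda>. [:- x, 1:]) = 0\<^sub>m n n"
  using assms
\<comment> \<open>\<open>p\<close> is the part still to be factored, \<Lambda> the set of positive
  roots found so far.\<close>
proof (induction "degree p" arbitrary: p \<Lambda> rule: less_induct)
  case less
  let ?\<Pi> = "\<lambda>\<Lambda>. \<Prod>x\<in>\<Lambda>. [:- x, 1::real:]"
  note cancel = mat_poly_mult_eq_0_cancel[OF carrier]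
  show ?case
  proof (cases "degree p = 0")
    case True
    then obtain c where c: "p = [:c:]" "c \<noteq> 0" using less.prems(1) by (metis degree_eq_zeroE pCons_0_0)
    have "mat_poly A (?\<Pi> \<Lambda>) = 0\<^sub>m n n"
    proof (rule cancel[OF less.prems(4)])
      fix v :: "real vec" assume v: "v \<in> carrier_vec n" and "mat_poly A p *\<^sub>v v = 0\<^sub>v n"
      moreover have "mat_poly A p *\<^sub>v v = c \<cdot>\<^sub>v v"
        unfolding c mat_poly_const[OF carrier] using v by (intro eq_vecI) auto
      ultimately have cv: "c \<cdot>\<^sub>v v = 0\<^sub>v n" by simp
      show "v = 0\<^sub>v n"
      proof (rule eq_vecI)
        fix i assume "i < dim_vec (0\<^sub>v n :: real vec)"
        then have i: "i < n" by simp
        then have "(c \<cdot>\<^sub>v v) $ i = 0" by (simp add: cv)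
        then show "v $ i = 0\<^sub>v n $ i" using i v c(2) by simp
      qed (use v in simp)
    qed
    then show ?thesis using less.prems by blast
  next
    case False
    then consider x q where "p = [:- x, 1:] * q"
      | x y q where "y \<noteq> 0" "p = ([:- x, 1:] * [:- x, 1:] + [:y\<^sup>2:]) * q"
      using real_poly_complex_root[of p] by blast
    then show ?thesis
    proof cases
      case 1
      define l where "l = [:- x, 1:]"
      have p: "p = l * q" and l: "l \<noteq> 0" "degree l = 1" by (simp_all only: 1 l_def) simp_all
      have q: "q \<noteq> 0" "degree q < degree p"
        using less.prems(1) l by (auto simp: p degree_mult_eq)
      \<comment> \<open>A nonpositive root is cancelled, a positive root already in \<Lambda> is a
        repetition and is dropped, and a new positive root moves into \<Lambda>.\<close>
      consider "x \<le> 0" | "0 < x" "x \<in> \<Lambda>" | "0 < x" "x \<notin> \<Lambda>" by linarith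
      then show ?thesis
      proof cases
        case 11: 1
        have "mat_poly A (l * (q * ?\<Pi> \<Lambda>)) = 0\<^sub>m n n"
          using less.prems(4) by (simp only: p mult.assoc)
        then have "mat_poly A (q * ?\<Pi> \<Lambda>) = 0\<^sub>m n n"
          by (rule cancel) (use linear_factor_inj[OF _ 11] in \<open>simp only: l_def\<close>)
        then show ?thesis using less.hyps[OF q(2,1)] less.prems by blast
      next
        case 12: 2
        define s where "s = q * ?\<Pi> (\<Lambda> - {x})"
        have \<Pi>: "?\<Pi> \<Lambda> = l * ?\<Pi> (\<Lambda> - {x})"
          unfolding l_def by (rule prod.remove[OF less.prems(2) 12(2)])
        have eqs: "p * ?\<Pi> \<Lambda> = (l * l) * s" "q * ?\<Pi> \<Lambda> = l * s"
          unfolding p \<Pi> s_def by (simp_all only: mult_ac)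
        have "mat_poly A (l * s) = 0\<^sub>m n n"
        proof (rule eq_matI)
          note [simp] = mat_poly_carrier[OF carrier] mat_poly_dim[OF carrier]
          fix i j assume "i < dim_row (0\<^sub>m n n :: real mat)" "j < dim_col (0\<^sub>m n n :: real mat)"
          then have ij: "i < n" "j < n" by auto
          have colm: "mat_poly A r *\<^sub>v col (mat_poly A s) j = col (mat_poly A (r * s)) j" for r s
            using ij by (intro eq_vecI) (auto simp: mat_poly_mult[OF carrier])
          have "mat_poly A (l * l) *\<^sub>v col (mat_poly A s) j = 0\<^sub>v n"
            unfolding colm using less.prems(4) ij by (simp only: eqs) simp
          then have "mat_poly A l *\<^sub>v col (mat_poly A s) j = 0\<^sub>v n"
            by (rule mat_poly_square_vec_eq_0[rotated]) (simp add: carrier_vecI)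
          then have "col (mat_poly A (l * s)) j $ i = 0" unfolding colm using ij by simp
          then show "mat_poly A (l * s) $$ (i, j) = 0\<^sub>m n n $$ (i, j)" using ij by simp
        qed (simp_all add: mat_poly_dim[OF carrier])
        then have "mat_poly A (q * ?\<Pi> \<Lambda>) = 0\<^sub>m n n" by (simp only: eqs)
        then show ?thesis using less.hyps[OF q(2,1)] less.prems by blast
      next
        case 13: 3
        have "?\<Pi> (insert x \<Lambda>) = l * ?\<Pi> \<Lambda>"
          unfolding l_def by (rule prod.insert[OF less.prems(2) 13(2)])
        then have "p * ?\<Pi> \<Lambda> = q * ?\<Pi> (insert x \<Lambda>)"
          unfolding p by (simp only: mult_ac)
        then have "mat_poly A (q * ?\<Pi> (insert x \<Lambda>)) = 0\<^sub>m n n" using less.prems(4) by simp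
        moreover have "finite (insert x \<Lambda>)" "\<forall>y\<in>insert x \<Lambda>. 0 < y" using 13 less.prems by auto
        ultimately show ?thesis using less.hyps[OF q(2,1)] by blast
      qed
    next
      case 2
      define d where "d = [:- x, 1:] * [:- x, 1:] + [:y\<^sup>2:]"
      have p: "p = d * q" by (simp only: 2 d_def)
      have d: "degree d = 2" "d \<noteq> 0" by (simp_all add: d_def)
      have q: "q \<noteq> 0" "degree q < degree p"
        using less.prems(1) d by (auto simp: p degree_mult_eq)
      have "mat_poly A (d * (q * ?\<Pi> \<Lambda>)) = 0\<^sub>m n n"
        using less.prems(4) by (simp only: p mult.assoc)
      then have "mat_poly A (q * ?\<Pi> \<Lambda>) = 0\<^sub>m n n"
        by (rule cancel) (use quadratic_factor_inj[OF _ 2(1)] in \<open>simp only: d_def\<close>)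
      then show ?thesis using less.hyps[OF q(2,1)] less.prems by blast
    qed
  qed
qed

text \<open>Stands in for the spectral theorem: polynomials that agree on \<Lambda> agree at
  \<open>A\<close>, so functions of \<open>A\<close> can be formed by interpolation on
  \<Lambda>.\<close>

lemma annihilator_distinct_pos_roots:
  obtains \<Lambda> where "finite \<Lambda>" "\<And>x. x \<in> \<Lambda> \<Longrightarrow> 0 < x" "mat_poly A (\<Prod>x\<in>\<Lambda>. [:- x, 1:]) = 0\<^sub>m n n"
proof -
  obtain p where "p \<noteq> 0" "mat_poly A p = 0\<^sub>m n n" by (rule mat_poly_annihilator[OF carrier])
  then show ?thesis using annihilator_reduce[of p "{}"] that by auto
qed

end

section \<open>Interpolation and the square root\<close>

lemma poly_interpolation_exists:
  fixes f :: "'a::field \<Rightarrow> 'a"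
  assumes "finite \<Lambda>"
  shows "\<exists>q. \<forall>x\<in>\<Lambda>. poly q x = f x"
  using assms
proof induction
  case (insert y \<Lambda>)
  then obtain q where q: "\<forall>x\<in>\<Lambda>. poly q x = f x" by blast
  define r where "r = (\<Prod>x\<in>\<Lambda>. [:- x, 1:])"
  have r: "poly r x = 0 \<longleftrightarrow> x \<in> \<Lambda>" for x
    using insert.hyps by (auto simp: r_def poly_prod)
  \<comment> \<open>Newton's correction term: \<open>r\<close> vanishes at the old nodes and not at
    \<open>y\<close>.\<close>
  define q' where "q' = q + smult ((f y - poly q y) / poly r y) r"
  have "poly q' x = f x" if "x \<in> insert y \<Lambda>" for x
    using that q r insert.hyps by (cases "x = y") (auto simp: q'_def)
  then show ?case by blast
qed auto

lemma prod_linear_factors_dvd: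
  fixes p :: "'a::field poly"
  assumes "finite \<Lambda>" "\<And>x. x \<in> \<Lambda> \<Longrightarrow> poly p x = 0"
  shows "(\<Prod>x\<in>\<Lambda>. [:- x, 1:]) dvd p"
  using assms
proof induction
  case (insert y \<Lambda>)
  define r where "r = (\<Prod>x\<in>\<Lambda>. [:- x, 1:])"
  obtain k where k: "p = r * k" using insert unfolding r_def by (auto elim: dvdE)
  have "poly r y \<noteq> 0" using insert.hyps by (auto simp: r_def poly_prod)
  then have "poly k y = 0" using insert.prems[of y] by (simp add: k)
  then have "[:- y, 1:] dvd k" by (simp add: poly_eq_0_iff_dvd)
  then have "[:- y, 1:] * r dvd p" unfolding k by (metis mult.commute mult_dvd_mono dvd_refl)
  then show ?case unfolding r_def prod.insert[OF insert.hyps] .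
qed auto

lemma mat_eq_via_mult_vec:
  fixes A B :: "'a::comm_ring_1 mat"
  assumes A: "A \<in> carrier_mat n n" and B: "B \<in> carrier_mat n n"
    and eq: "\<And>x. x \<in> carrier_vec n \<Longrightarrow> A *\<^sub>v x = B *\<^sub>v x"
  shows "A = B"
proof (rule eq_matI)
  fix i j assume "i < dim_row B" "j < dim_col B"
  then have ij: "i < n" "j < n" using B by auto
  then have "(A *\<^sub>v unit_vec n j) $ i = (B *\<^sub>v unit_vec n j) $ i"
    by (simp add: eq)
  then show "A $$ (i, j) = B $$ (i, j)" using A B ij by simp
qed (use A B in auto)

context pos_def_mat
begin

lemma mat_poly_X: "mat_poly A [:0, 1:] = A"
proof -
  have "(0::real) \<cdot>\<^sub>m 1\<^sub>m n + A = A" using carrier by (intro eq_matI) auto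
  then show ?thesis
    using mat_poly_1[OF carrier] carrier
    by (simp add: mat_poly_pCons[OF carrier, of 0] one_pCons)
qed

text \<open>Interpolating the fourth root, and not the square root, on the roots of the annihilator makes the
  square root of \<open>A\<close> the square of a symmetric matrix, which shows that it is positive semidefinite.\<close>

lemma pos_sqrt_mat_poly:
  obtains q where "mat_poly A (q * q) * mat_poly A (q * q) = A"
proof -
  obtain \<Lambda> where \<Lambda>: "finite \<Lambda>" "\<And>x. x \<in> \<Lambda> \<Longrightarrow> 0 < x"
    and annih: "mat_poly A (\<Prod>x\<in>\<Lambda>. [:- x, 1:]) = 0\<^sub>m n n"
    using annihilator_distinct_pos_roots by blast
  obtain q where q: "\<forall>x\<in>\<Lambda>. poly q x = sqrt (sqrt x)"
    using poly_interpolation_exists[OF \<Lambda>(1), of "\<lambda>x. sqrt (sqrt x)"] by blast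
  define r where "r = q * q * (q * q) - [:0, 1:]"
  have "(\<Prod>x\<in>\<Lambda>. [:- x, 1:]) dvd r"
  proof (rule prod_linear_factors_dvd[OF \<Lambda>(1)])
    fix x assume "x \<in> \<Lambda>"
    with \<Lambda>(2)[OF this] q show "poly r x = 0" by (simp add: r_def)
  qed
  then obtain k where "r = (\<Prod>x\<in>\<Lambda>. [:- x, 1:]) * k" ..
  then have "mat_poly A r = 0\<^sub>m n n"
    by (simp only: mat_poly_mult[OF carrier] annih left_mult_zero_mat[OF mat_poly_carrier[OF carrier]])
  have "mat_poly A (q * q) * mat_poly A (q * q) = mat_poly A (r + [:0, 1:])"
    by (simp add: r_def mat_poly_mult[OF carrier])
  also have "\<dots> = A"
    unfolding mat_poly_add[OF carrier] \<open>mat_poly A r = _\<close> mat_poly_X using carrier by simp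
  finally show ?thesis by (rule that)
qed

text \<open>Put S = q(A)q(A). Since \<open>B\<close> commutes with \<open>A\<close>, it commutes
  with S, and y = Sx - Bx satisfies (S + B)y = (SS - BB)x = 0. Both forms y.Sy and y.By are
  nonnegative, hence zero. As y.Sy is the squared norm of q(A)y, this gives q(A)y = 0, then Ay = 0
  and y = 0.\<close>

lemma psd_mat_square_root_unique:
  assumes q: "mat_poly A (q * q) * mat_poly A (q * q) = A"
    and B: "psd_mat n B" "B * B = A"
  shows "B = mat_poly A (q * q)"
proof -
  define S where "S = mat_poly A (q * q)"
  have S: "S \<in> carrier_mat n n" unfolding S_def by (rule mat_poly_carrier[OF carrier])
  have Bc: "B \<in> carrier_mat n n" using B(1) by (simp add: psd_mat_def)
  have "B * A = A * B" using assoc_mult_mat[OF Bc Bc Bc] B(2) by simp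
  then have comm: "B * S = S * B"
    unfolding S_def by (rule mat_poly_commute[OF carrier Bc])
  have "S *\<^sub>v x = B *\<^sub>v x" if x: "x \<in> carrier_vec n" for x
  proof -
    have cv [simp]: "S *\<^sub>v v \<in> carrier_vec n" "B *\<^sub>v v \<in> carrier_vec n" if "v \<in> carrier_vec n" for v
      using S Bc that by auto
    define y where "y = S *\<^sub>v x - B *\<^sub>v x"
    have y: "y \<in> carrier_vec n" using x by (simp add: y_def)
    have SS: "S *\<^sub>v (S *\<^sub>v v) = A *\<^sub>v v" "B *\<^sub>v (B *\<^sub>v v) = A *\<^sub>v v" "B *\<^sub>v (S *\<^sub>v v) = S *\<^sub>v (B *\<^sub>v v)"
      if "v \<in> carrier_vec n" for v
      using q B(2) comm assoc_mult_mat_vec[OF S S that] assoc_mult_mat_vec[OF Bc Bc that]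
        assoc_mult_mat_vec[OF S Bc that] assoc_mult_mat_vec[OF Bc S that]
      by (simp_all add: S_def)
    have Sy: "S *\<^sub>v y = A *\<^sub>v x - S *\<^sub>v (B *\<^sub>v x)"
      using x mult_minus_distrib_mat_vec[OF S cv(1)[OF x] cv(2)[OF x]] by (simp add: y_def SS)
    have By: "B *\<^sub>v y = S *\<^sub>v (B *\<^sub>v x) - A *\<^sub>v x"
      using x mult_minus_distrib_mat_vec[OF Bc cv(1)[OF x] cv(2)[OF x]] by (simp add: y_def SS)
    have "A *\<^sub>v x \<in> carrier_vec n" "S *\<^sub>v (B *\<^sub>v x) \<in> carrier_vec n" using x carrier by auto
    then have "B *\<^sub>v y = - (S *\<^sub>v y)" unfolding Sy By using S carrier by (intro eq_vecI) auto
    then have "y \<bullet> (S *\<^sub>v y) + y \<bullet> (B *\<^sub>v y) = 0"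
      using S y by (simp add: scalar_prod_def sum_negf)
    moreover have "0 \<le> y \<bullet> (B *\<^sub>v y)" using B(1) y by (simp add: psd_mat_def)
    moreover have eq: "y \<bullet> (S *\<^sub>v y) = (mat_poly A q *\<^sub>v y) \<bullet> (mat_poly A q *\<^sub>v y)"
      unfolding S_def by (rule mat_poly_square_vec[OF y])
    moreover have "0 \<le> y \<bullet> (S *\<^sub>v y)" unfolding eq by (rule real_scalar_prod_self_ge_0)
    ultimately have "(mat_poly A q *\<^sub>v y) \<bullet> (mat_poly A q *\<^sub>v y) = 0" by linarith
    then have Ry: "mat_poly A q *\<^sub>v y = 0\<^sub>v n"
      using mult_mat_vec_carrier[OF mat_poly_carrier[OF carrier] y]
      by (rule real_scalar_prod_self_eq_0[rotated])
    have "mat_poly A q *\<^sub>v 0\<^sub>v n = 0\<^sub>v n"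
      using mat_poly_carrier[OF carrier, of q] by (intro eq_vecI) auto
    then have "S *\<^sub>v y = 0\<^sub>v n"
      unfolding S_def mat_poly_mult[OF carrier] using Ry
      by (simp add: assoc_mult_mat_vec[OF mat_poly_carrier[OF carrier] mat_poly_carrier[OF carrier] y])
    moreover have "S *\<^sub>v 0\<^sub>v n = 0\<^sub>v n" using S by (intro eq_vecI) auto
    ultimately have "A *\<^sub>v y = 0\<^sub>v n" using SS(1)[OF y] by simp
    then have "y = 0\<^sub>v n" by (rule inj[OF y])
    show ?thesis
    proof (rule eq_vecI)
      fix i assume "i < dim_vec (B *\<^sub>v x)"
      then have i: "i < n" using Bc by simp
      then have "y $ i = 0" by (simp add: \<open>y = 0\<^sub>v n\<close>)
      then show "(S *\<^sub>v x) $ i = (B *\<^sub>v x) $ i" using i Bc by (simp add: y_def)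
    qed (use S Bc in simp)
  qed
  then show ?thesis using mat_eq_via_mult_vec[OF S Bc] by (simp add: S_def)
qed

lemma sqrt_mat_properties: "psd_mat n (sqrt_mat A) \<and> sqrt_mat A * sqrt_mat A = A"
proof -
  obtain q where q: "mat_poly A (q * q) * mat_poly A (q * q) = A" by (rule pos_sqrt_mat_poly)
  have "psd_mat n (mat_poly A (q * q))"
    using mat_poly_carrier[OF carrier, of "q * q"] mat_poly_transpose[OF carrier sym, of "q * q"]
    by (simp add: psd_mat_def mat_poly_square_vec real_scalar_prod_self_ge_0)
  \<comment> \<open>\<open>sqrt_mat\<close> is a definite description, so both existence and
    uniqueness are required to unfold it.\<close>
  then have "\<exists>!B. psd_mat n B \<and> B * B = A"
    using q psd_mat_square_root_unique[OF q] by blast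
  then have "psd_mat n (THE B. psd_mat n B \<and> B * B = A) \<and>
      (THE B. psd_mat n B \<and> B * B = A) * (THE B. psd_mat n B \<and> B * B = A) = A"
    by (rule theI')
  then show ?thesis using carrier by (simp add: sqrt_mat_def)
qed

text \<open>The vector \<open>p\<close> is the inverse of \<open>A\<close> applied to
  \<open>a\<close>. Through it the norm of the whitened vector becomes a scalar product, and the
  covering argument can work without the square root.\<close>

lemma inv_sqrt_mat_whitening:
  assumes a: "a \<in> carrier_vec n"
  obtains p where "p \<in> carrier_vec n" "A *\<^sub>v p = a"
    "a \<bullet> p = (l2_norm (inv_mat (sqrt_mat A) *\<^sub>v a))\<^sup>2"
proof -
  define S where "S = sqrt_mat A"
  have S: "S \<in> carrier_mat n n" "transpose_mat S = S" "S * S = A"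
    using sqrt_mat_properties by (auto simp: S_def psd_mat_def)
  have "det S \<noteq> 0"
  proof
    assume "det S = 0"
    then obtain v where v: "v \<in> carrier_vec n" "v \<noteq> 0\<^sub>v n" "S *\<^sub>v v = 0\<^sub>v n"
      using det_0_iff_vec_prod_zero[OF S(1)] by auto
    have "A *\<^sub>v v = S *\<^sub>v (S *\<^sub>v v)"
      unfolding S(3)[symmetric] by (rule assoc_mult_mat_vec[OF S(1) S(1) v(1)])
    also have "\<dots> = 0\<^sub>v n" unfolding v(3) using S(1) by (intro eq_vecI) auto
    finally show False using inj v by blast
  qed
  \<comment> \<open>\<open>inv_mat\<close> takes \<open>the\<close> of an option; invertibility
    ensures that this option is not \<open>None\<close>.\<close>
  then have "S \<in> Units (ring_mat TYPE(real) n ())" by (rule det_non_zero_imp_unit[OF S(1)])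
  then obtain V where V: "mat_inverse S = Some V"
    using mat_inverse(1)[OF S(1), of "()"] by (cases "mat_inverse S") auto
  then have SV: "S * V = 1\<^sub>m n" "V * S = 1\<^sub>m n" "V \<in> carrier_mat n n"
    using mat_inverse(2)[OF S(1)] by auto
  have VT: "transpose_mat V \<in> carrier_mat n n" using SV(3) by simp
  have VTS: "transpose_mat V * S = 1\<^sub>m n"
    using transpose_mult[OF S(1) SV(3)] S(2) SV(1) by simp
  \<comment> \<open>The transpose of \<open>V\<close> is a left inverse of the symmetric
    \<open>S\<close>, hence equal to \<open>V\<close>.\<close>
  have "transpose_mat V = transpose_mat V * (S * V)" using SV VT by simp
  also have "\<dots> = V"
    using assoc_mult_mat[OF VT S(1) SV(3)] VTS SV(3) by simp
  finally have VTV: "transpose_mat V = V" .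
  define b where "b = V *\<^sub>v a"
  have b: "b \<in> carrier_vec n" using a SV(3) by (simp add: b_def)
  define p where "p = V *\<^sub>v b"
  have p: "p \<in> carrier_vec n" using b SV(3) by (simp add: p_def)
  have "S *\<^sub>v p = b"
    using assoc_mult_mat_vec[OF S(1) SV(3) b] SV(1) b by (simp add: p_def)
  moreover have "S *\<^sub>v b = a"
    using assoc_mult_mat_vec[OF S(1) SV(3) a] SV(1) a by (simp add: b_def)
  ultimately have "A *\<^sub>v p = a"
    using assoc_mult_mat_vec[OF S(1) S(1) p] S(3) by simp
  moreover have "a \<bullet> p = b \<bullet> b"
    using symmetric_mat_scalar_prod[OF SV(3) VTV a b] by (simp add: p_def b_def)
  moreover have "(l2_norm (inv_mat (sqrt_mat A) *\<^sub>v a))\<^sup>2 = b \<bullet> b"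
    using V by (simp add: inv_mat_def S_def[symmetric] l2_norm_def b_def real_scalar_prod_self_ge_0)
  ultimately show ?thesis using that p by simp
qed

end

section \<open>Covering by greedy approximation\<close>

lemma weight_mat_carrier [simp]: "weight_mat n m a w \<in> carrier_mat n n"
  by (simp add: weight_mat_def)

lemma weight_mat_bilinear:
  assumes "\<And>i. i < m \<Longrightarrow> a i \<in> carrier_vec n" and x: "x \<in> carrier_vec n" and y: "y \<in> carrier_vec n"
  shows "x \<bullet> (weight_mat n m a w *\<^sub>v y) = (\<Sum>j<m. w j * (a j \<bullet> x) * (a j \<bullet> y))"
proof -
  have d: "dim_vec x = n" "dim_vec y = n" using x y by auto
  have "x \<bullet> (weight_mat n m a w *\<^sub>v y) =
      (\<Sum>r<n. x $ r * (\<Sum>s<n. (\<Sum>j<m. w j * (a j $ r * a j $ s)) * y $ s))"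
    using d by (simp add: scalar_prod_def weight_mat_def atLeast0LessThan)
  also have "\<dots> = (\<Sum>r<n. \<Sum>s<n. \<Sum>j<m. w j * (a j $ r * x $ r) * (a j $ s * y $ s))"
    by (simp add: sum_distrib_left sum_distrib_right mult_ac)
  also have "\<dots> = (\<Sum>r<n. \<Sum>j<m. \<Sum>s<n. w j * (a j $ r * x $ r) * (a j $ s * y $ s))"
    by (rule sum.cong[OF refl], rule sum.swap)
  also have "\<dots> = (\<Sum>j<m. \<Sum>r<n. \<Sum>s<n. w j * (a j $ r * x $ r) * (a j $ s * y $ s))"
    by (rule sum.swap)
  also have "\<dots> = (\<Sum>j<m. w j * (a j \<bullet> x) * (a j \<bullet> y))"
    using d by (simp add: scalar_prod_def atLeast0LessThan sum_distrib_left sum_distrib_right mult_ac)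
  finally show ?thesis .
qed

lemma weight_mat_pos_def:
  assumes a: "\<And>i. i < m \<Longrightarrow> a i \<in> carrier_vec n" and w: "\<And>i. i < m \<Longrightarrow> 0 \<le> w i"
    and inv: "invertible_mat (weight_mat n m a w)"
  shows "pos_def_mat (weight_mat n m a w) n"
proof
  let ?M = "weight_mat n m a w"
  show "?M \<in> carrier_mat n n" by simp
  show "transpose_mat ?M = ?M" by (rule eq_matI) (auto simp: weight_mat_def mult_ac)
  fix x :: "real vec" assume x: "x \<in> carrier_vec n"
  show "0 \<le> x \<bullet> (?M *\<^sub>v x)"
    using w by (auto simp: weight_mat_bilinear[OF a x x] mult.assoc intro!: sum_nonneg)
  obtain B where B: "B * ?M = 1\<^sub>m (dim_row B)" "?M * B = 1\<^sub>m n"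
    using inv by (auto simp: invertible_mat_def inverts_mat_def weight_mat_def)
  have "dim_col B = n" using B(2) by (metis index_mult_mat(3) index_one_mat(3))
  moreover have "dim_row B = n"
    using B(1) by (metis index_mult_mat(3) index_one_mat(3) weight_mat_carrier carrier_matD(2))
  ultimately have Bc: "B \<in> carrier_mat n n" by auto
  assume "?M *\<^sub>v x = 0\<^sub>v n"
  then have "B *\<^sub>v (?M *\<^sub>v x) = 0\<^sub>v n" using Bc by (auto intro!: eq_vecI)
  moreover have "B *\<^sub>v (?M *\<^sub>v x) = x"
    using assoc_mult_mat_vec[OF Bc _ x, of ?M] B(1) Bc x by simp
  ultimately show "x = 0\<^sub>v n" by simp
qed

text \<open>The intended \<open>p i\<close> is the inverse of the weight matrix applied to
  \<open>a i\<close>. It represents the functional \<open>a i\<close> in the inner product of the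
  weight matrix, and \<open>r i\<close> is its norm there.\<close>

locale dual_vectors =
  fixes n m :: nat and a :: "nat \<Rightarrow> real vec" and w r :: "nat \<Rightarrow> real" and p :: "nat \<Rightarrow> real vec"
  assumes a_carrier [simp]: "i < m \<Longrightarrow> a i \<in> carrier_vec n"
    and w_pos: "i < m \<Longrightarrow> 0 < w i"
    and r_pos: "i < m \<Longrightarrow> 0 < r i"
    and p_carrier [simp]: "i < m \<Longrightarrow> p i \<in> carrier_vec n"
    and reproducing: "i < m \<Longrightarrow> x \<in> carrier_vec n \<Longrightarrow> (\<Sum>j<m. w j * (a j \<bullet> x) * (a j \<bullet> p i)) = a i \<bullet> x"
    and scalar_prod_dual: "i < m \<Longrightarrow> a i \<bullet> p i = (r i)\<^sup>2"
begin

text \<open>The squared norm of U x, where U is the square root of the weight matrix.\<close>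

definition energy :: "real vec \<Rightarrow> real" where
  "energy x = (\<Sum>j<m. w j * (a j \<bullet> x)\<^sup>2)"

definition oscillation_le :: "real \<Rightarrow> real vec set \<Rightarrow> bool" where
  "oscillation_le u S \<longleftrightarrow> (\<forall>x\<in>S. \<forall>y\<in>S. \<forall>i<m. \<bar>a i \<bullet> (x - y)\<bar> \<le> u * r i)"

text \<open>The pieces are subsets of \<open>S\<close> because energy estimates will be available
  only for differences of points of \<open>S\<close>.\<close>

definition coverable :: "real vec set \<Rightarrow> nat \<Rightarrow> real \<Rightarrow> bool" where
  "coverable S N u \<longleftrightarrow> (\<exists>\<A>. finite \<A> \<and> card \<A> \<le> N \<and> S \<subseteq> \<Union>\<A> \<and> (\<forall>A\<in>\<A>. A \<subseteq> S \<and> oscillation_le u A))"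

lemma scalar_prod_shift:
  assumes "j < m" "i < m" "x \<in> carrier_vec n"
  shows "a j \<bullet> (x - s \<cdot>\<^sub>v p i) = a j \<bullet> x - s * (a j \<bullet> p i)"
  using assms by (simp add: scalar_prod_minus_distrib[of _ n] scalar_prod_smult_distrib[of _ n])

lemma energy_nonneg: "0 \<le> energy x"
  unfolding energy_def using w_pos by (intro sum_nonneg mult_nonneg_nonneg) (auto intro: less_imp_le)

lemma energy_shift:
  assumes i: "i < m" and x: "x \<in> carrier_vec n"
  shows "energy (x - s \<cdot>\<^sub>v p i) = energy x - 2 * s * (a i \<bullet> x) + s\<^sup>2 * (r i)\<^sup>2"
proof -
  have "energy (x - s \<cdot>\<^sub>v p i) = (\<Sum>j<m. w j * (a j \<bullet> x)\<^sup>2 - 2 * s * (w j * (a j \<bullet> x) * (a j \<bullet> p i))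
      + s\<^sup>2 * (w j * (a j \<bullet> p i) * (a j \<bullet> p i)))"
    unfolding energy_def using i x
    by (intro sum.cong) (auto simp: scalar_prod_shift power2_eq_square algebra_simps)
  also have "\<dots> = energy x - 2 * s * (\<Sum>j<m. w j * (a j \<bullet> x) * (a j \<bullet> p i))
      + s\<^sup>2 * (\<Sum>j<m. w j * (a j \<bullet> p i) * (a j \<bullet> p i))"
    by (simp add: energy_def sum.distrib sum_subtractf sum_distrib_left)
  finally show ?thesis using i x by (simp add: reproducing scalar_prod_dual)
qed

text \<open>Cauchy-Schwarz for the pairing of \<open>x\<close> with \<open>p i\<close>, read off
  from the nonnegativity of the energy at its minimum along the direction
  \<open>p i\<close>.\<close>

lemma coordinate_le_energy:
  assumes i: "i < m" and x: "x \<in> carrier_vec n"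
  shows "\<bar>a i \<bullet> x\<bar> \<le> sqrt (energy x) * r i"
proof -
  define s where "s = (a i \<bullet> x) / (r i)\<^sup>2"
  have "0 \<le> energy (x - s \<cdot>\<^sub>v p i)" by (rule energy_nonneg)
  also have "\<dots> = energy x - (a i \<bullet> x)\<^sup>2 / (r i)\<^sup>2"
    using r_pos[OF i] by (simp add: energy_shift[OF i x] s_def field_simps power2_eq_square)
  finally have "(a i \<bullet> x)\<^sup>2 \<le> energy x * (r i)\<^sup>2"
    using r_pos[OF i] by (simp add: field_simps)
  then have "sqrt ((a i \<bullet> x)\<^sup>2) \<le> sqrt (energy x * (r i)\<^sup>2)" by (rule real_sqrt_le_mono)
  then show ?thesis using r_pos[OF i] by (simp add: real_sqrt_mult)
qed

text \<open>Dual Sudakov inequality without Gaussians: as long as some coordinate of \<open>x\<close> exceeds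
  \<open>\<delta> * r i\<close>, moving \<open>x\<close> by \<open>\<delta> / r i\<close> along \<open>\<plusminus> p i\<close> lowers the energy by at least \<open>\<delta>\<^sup>2\<close>.
  Hence \<open>x\<close> is approximated by one of at most \<open>(2 * m + 1) ^ k\<close> sums of \<open>k\<close> such steps.\<close>

lemma greedy_cover:
  assumes \<delta>: "0 < \<delta>"
  shows "\<exists>T. finite T \<and> T \<subseteq> carrier_vec n \<and> card T \<le> (2 * m + 1) ^ k \<and>
    (\<forall>x\<in>carrier_vec n. energy x \<le> real k * \<delta>\<^sup>2 \<longrightarrow> (\<exists>t\<in>T. \<forall>i<m. \<bar>a i \<bullet> (x - t)\<bar> \<le> \<delta> * r i))"
proof (induction k)
  case 0
  have "\<bar>a i \<bullet> (x - 0\<^sub>v n)\<bar> \<le> \<delta> * r i" if "x \<in> carrier_vec n" "energy x \<le> 0" "i < m" for x i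
  proof -
    have "\<bar>a i \<bullet> x\<bar> \<le> sqrt (energy x) * r i" using that by (intro coordinate_le_energy)
    also have "energy x = 0" using that(2) energy_nonneg[of x] by simp
    finally show ?thesis using that \<delta> r_pos[OF that(3)] by simp
  qed
  then show ?case by (intro exI[of _ "{0\<^sub>v n}"]) auto
next
  case (Suc k)
  then obtain T where T: "finite T" "T \<subseteq> carrier_vec n" "card T \<le> (2 * m + 1) ^ k"
    and cov: "\<And>x. x \<in> carrier_vec n \<Longrightarrow> energy x \<le> real k * \<delta>\<^sup>2 \<Longrightarrow> \<exists>t\<in>T. \<forall>i<m. \<bar>a i \<bullet> (x - t)\<bar> \<le> \<delta> * r i"
    by blast
  define I where "I = {..<m} \<times> {\<delta>, - \<delta>}"
  define g where "g = (\<lambda>((i, s), t). t + (s / r i) \<cdot>\<^sub>v p i)"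
  \<comment> \<open>The zero vector serves points that need no further step; its one extra element
    is absorbed by the base \<open>2 * m + 1\<close>.\<close>
  define T' where "T' = insert (0\<^sub>v n) (g ` (I \<times> T))"
  have "card I = 2 * m" using \<delta> by (simp add: I_def card_cartesian_product)
  then have "card (I \<times> T) = 2 * m * card T" by (simp add: card_cartesian_product)
  moreover have fin: "finite I" "finite (I \<times> T)" using T by (auto simp: I_def)
  ultimately have "card (g ` (I \<times> T)) \<le> 2 * m * card T" using card_image_le[of "I \<times> T" g] by simp
  then have "card T' \<le> 2 * m * card T + 1"
    using fin by (simp add: T'_def card_insert_if)
  also have "\<dots> \<le> 2 * m * (2 * m + 1) ^ k + (2 * m + 1) ^ k"
    using T(3) by (intro add_mono mult_le_mono2) auto
  also have "\<dots> = (2 * m + 1) ^ Suc k" by simp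
  finally have "card T' \<le> (2 * m + 1) ^ Suc k" .
  moreover have "finite T'" using fin by (simp add: T'_def)
  moreover have "T' \<subseteq> carrier_vec n" using T(2) by (auto simp: T'_def I_def g_def)
  moreover have "\<exists>t\<in>T'. \<forall>i<m. \<bar>a i \<bullet> (x - t)\<bar> \<le> \<delta> * r i"
    if x: "x \<in> carrier_vec n" and en: "energy x \<le> real (Suc k) * \<delta>\<^sup>2" for x
  proof (cases "\<forall>i<m. \<bar>a i \<bullet> x\<bar> \<le> \<delta> * r i")
    case True
    then show ?thesis using x by (intro bexI[of _ "0\<^sub>v n"]) (auto simp: T'_def)
  next
    case False
    then obtain i where i: "i < m" and large: "\<delta> * r i < \<bar>a i \<bullet> x\<bar>" by auto
    define s where "s = (if 0 < a i \<bullet> x then \<delta> else - \<delta>)"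
    have ri: "0 < r i" using r_pos[OF i] .
    define x' where "x' = x - (s / r i) \<cdot>\<^sub>v p i"
    have x': "x' \<in> carrier_vec n" using x i by (simp add: x'_def)
    have "energy x' = energy x - 2 * (\<delta> * \<bar>a i \<bullet> x\<bar> / r i) + \<delta>\<^sup>2"
      using ri by (simp add: x'_def energy_shift[OF i x] s_def power2_eq_square)
    moreover have "\<delta>\<^sup>2 \<le> \<delta> * \<bar>a i \<bullet> x\<bar> / r i"
      using large ri \<delta> by (simp add: field_simps power2_eq_square)
    moreover have "energy x \<le> real k * \<delta>\<^sup>2 + \<delta>\<^sup>2" using en by (simp add: algebra_simps)
    ultimately have "energy x' \<le> real k * \<delta>\<^sup>2" by linarith
    then obtain t where t: "t \<in> T" "\<forall>j<m. \<bar>a j \<bullet> (x' - t)\<bar> \<le> \<delta> * r j" using cov[OF x'] by blast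
    define t' where "t' = t + (s / r i) \<cdot>\<^sub>v p i"
    have "t' = g ((i, s), t)" by (simp add: t'_def g_def)
    then have "t' \<in> T'" using t(1) i by (auto simp: T'_def I_def s_def)
    moreover have "x - t' = x' - t"
      using x carrier_vecD[of t n] t(1) T(2) carrier_vecD[OF p_carrier[OF i]]
      by (intro eq_vecI) (auto simp: x'_def t'_def)
    ultimately show ?thesis using t(2) by (intro bexI[of _ t']) simp_all
  qed
  ultimately show ?case by blast
qed

text \<open>Each piece is translated by one of its own points, so that its elements become
  differences of low energy and \<open>greedy_cover\<close> applies. Two points within \<delta> of
  the same centre are within 2\<delta> of each other.\<close>

lemma coverable_refine:
  assumes S: "S \<subseteq> carrier_vec n" and cov: "coverable S N u" and \<delta>: "0 < \<delta>"
    and en: "\<And>x y. x \<in> S \<Longrightarrow> y \<in> S \<Longrightarrow> (\<And>i. i < m \<Longrightarrow> \<bar>a i \<bullet> (x - y)\<bar> \<le> u * r i) \<Longrightarrow> energy (x - y) \<le> real k * \<delta>\<^sup>2"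
  shows "coverable S (N * (2 * m + 1) ^ k) (2 * \<delta>)"
proof -
  obtain \<A> where \<A>: "finite \<A>" "card \<A> \<le> N" "S \<subseteq> \<Union>\<A>"
    and \<A>': "\<And>A. A \<in> \<A> \<Longrightarrow> A \<subseteq> S" "\<And>A. A \<in> \<A> \<Longrightarrow> oscillation_le u A"
    using cov unfolding coverable_def by blast
  obtain T where T: "finite T" "T \<subseteq> carrier_vec n" "card T \<le> (2 * m + 1) ^ k"
    and near: "\<And>x. x \<in> carrier_vec n \<Longrightarrow> energy x \<le> real k * \<delta>\<^sup>2 \<Longrightarrow> \<exists>t\<in>T. \<forall>i<m. \<bar>a i \<bullet> (x - t)\<bar> \<le> \<delta> * r i"
    using greedy_cover[OF \<delta>, of k] by blast
  define base where "base A = (SOME y. y \<in> A)" for A :: "real vec set"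
  define piece where "piece = (\<lambda>(A, t). {x \<in> A. \<forall>i<m. \<bar>a i \<bullet> (x - base A - t)\<bar> \<le> \<delta> * r i})"
  have "card (piece ` (\<A> \<times> T)) \<le> card \<A> * card T"
    using card_image_le[of "\<A> \<times> T" piece] \<A>(1) T(1) by (simp add: card_cartesian_product)
  also have "\<dots> \<le> N * (2 * m + 1) ^ k" using \<A>(2) T(3) by (rule mult_le_mono)
  finally have "card (piece ` (\<A> \<times> T)) \<le> N * (2 * m + 1) ^ k" .
  moreover have "finite (piece ` (\<A> \<times> T))" using \<A>(1) T(1) by simp
  moreover have "S \<subseteq> \<Union>(piece ` (\<A> \<times> T))"
  proof
    fix x assume x: "x \<in> S"
    then obtain A where A: "A \<in> \<A>" "x \<in> A" using \<A>(3) by blast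
    have b: "base A \<in> A" using A(2) unfolding base_def by (rule someI)
    have "energy (x - base A) \<le> real k * \<delta>\<^sup>2"
      using A b \<A>'[OF A(1)] x by (intro en) (auto simp: oscillation_le_def)
    moreover have "x - base A \<in> carrier_vec n" 
      using x b \<A>'(1)[OF A(1)] S by (intro minus_carrier_vec) auto
    ultimately obtain t where t: "t \<in> T" "\<forall>i<m. \<bar>a i \<bullet> (x - base A - t)\<bar> \<le> \<delta> * r i"
      using near by blast
    then have "x \<in> piece (A, t)" using A(2) by (simp add: piece_def)
    moreover have "(A, t) \<in> \<A> \<times> T" using A(1) t(1) by simp
    ultimately show "x \<in> \<Union>(piece ` (\<A> \<times> T))" by blast
  qed
  moreover have "B \<subseteq> S \<and> oscillation_le (2 * \<delta>) B" if B: "B \<in> piece ` (\<A> \<times> T)" for B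
  proof -
    obtain A t where At: "A \<in> \<A>" "t \<in> T" "B = piece (A, t)" using B by auto
    have AS: "A \<subseteq> S" using \<A>'(1) At(1) by blast
    have "\<bar>a i \<bullet> (x - y)\<bar> \<le> 2 * \<delta> * r i" if "x \<in> B" "y \<in> B" "i < m" for x y i
    proof -
      have xy: "x \<in> A" "y \<in> A" using that At by (auto simp: piece_def)
      have "base A \<in> A" using xy(1) unfolding base_def by (rule someI)
      then have car: "x \<in> carrier_vec n" "y \<in> carrier_vec n" "base A \<in> carrier_vec n" "t \<in> carrier_vec n"
        using xy AS S T(2) At(2) by auto
      have "a i \<bullet> (z - base A - t) = a i \<bullet> z - a i \<bullet> base A - a i \<bullet> t" if "z \<in> carrier_vec n" for z
        using that car \<open>i < m\<close> by (simp add: scalar_prod_minus_distrib[of _ n])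
      moreover have "\<bar>a i \<bullet> (x - base A - t)\<bar> \<le> \<delta> * r i" "\<bar>a i \<bullet> (y - base A - t)\<bar> \<le> \<delta> * r i"
        using that At(3) by (auto simp: piece_def)
      moreover have "a i \<bullet> (x - y) = a i \<bullet> x - a i \<bullet> y"
        using car \<open>i < m\<close> by (simp add: scalar_prod_minus_distrib[of _ n])
      ultimately show ?thesis using car by (simp add: abs_le_iff)
    qed
    then show ?thesis using At AS by (auto simp: oscillation_le_def piece_def)
  qed
  ultimately show ?thesis unfolding coverable_def by blast
qed

end

section \<open>Halving the oscillation\<close>

lemma two_power_powr: "((2::real) ^ k) powr (2 * \<theta>) = (4 powr \<theta>) ^ k"
proof -
  have "(4::real) powr \<theta> = 2 powr (2 * \<theta>)" by (simp add: powr_powr[symmetric])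
  then have "(4 powr \<theta>) ^ k = (2::real) powr (real k * (2 * \<theta>))"
    by (simp add: powr_power mult.commute)
  also have "\<dots> = (2 powr real k) powr (2 * \<theta>)" by (simp add: powr_powr)
  finally show ?thesis by (simp add: powr_realpow)
qed

context dual_vectors
begin

context
  fixes S :: "real vec set" and Q \<theta> :: real
  assumes S: "S \<subseteq> carrier_vec n" and Q: "1 \<le> Q" and \<theta>: "0 < \<theta>"
    and energy_growth: "\<And>x y u. x \<in> S \<Longrightarrow> y \<in> S \<Longrightarrow> 1 \<le> u \<Longrightarrow>
      (\<And>i. i < m \<Longrightarrow> \<bar>a i \<bullet> (x - y)\<bar> \<le> u * r i) \<Longrightarrow> energy (x - y) \<le> Q * u powr (2 - 2 * \<theta>)"
begin

lemma initial_radius_powr: "(Q powr (1 / (2 * \<theta>))) powr (2 * \<theta>) = Q"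
  using Q \<theta> by (simp add: powr_powr)

lemma initial_radius_ge_1: "1 \<le> Q powr (1 / (2 * \<theta>))"
  using Q \<theta> by (intro ge_one_powr_ge_zero) auto

text \<open>The growth estimate is applied at the radius u that is itself the root of the energy. If
  u \<ge> 1, it reads \<open>u\<^sup>2 \<le> Q * u powr (2 - 2 * \<theta>)\<close>, which bounds
  u.\<close>

lemma coverable_initial: "coverable S 1 (Q powr (1 / (2 * \<theta>)))"
proof -
  let ?u0 = "Q powr (1 / (2 * \<theta>))"
  have "\<bar>a i \<bullet> (x - y)\<bar> \<le> ?u0 * r i" if xy: "x \<in> S" "y \<in> S" and i: "i < m" for x y i
  proof -
    have car: "x - y \<in> carrier_vec n" using xy S by (intro minus_carrier_vec) auto
    define u where "u = sqrt (energy (x - y))"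
    have coord: "\<bar>a i \<bullet> (x - y)\<bar> \<le> u * r i" if "i < m" for i
      unfolding u_def using coordinate_le_energy[OF that car] .
    have "u \<le> ?u0"
    proof (cases "1 \<le> u")
      case True
      have "u\<^sup>2 = energy (x - y)" by (simp add: u_def energy_nonneg)
      also have "\<dots> \<le> Q * u powr (2 - 2 * \<theta>)" by (rule energy_growth[OF xy True coord])
      also have "\<dots> = Q * u\<^sup>2 / u powr (2 * \<theta>)"
        using True by (simp add: powr_diff)
      finally have "u\<^sup>2 * u powr (2 * \<theta>) \<le> u\<^sup>2 * Q" using True by (simp add: field_simps)
      then have "u powr (2 * \<theta>) \<le> Q" using True by simp
      then have "(u powr (2 * \<theta>)) powr (1 / (2 * \<theta>)) \<le> ?u0"
        using \<theta> by (intro powr_mono2) auto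
      then show ?thesis using True \<theta> by (simp add: powr_powr)
    next
      case False
      then show ?thesis using initial_radius_ge_1 by linarith
    qed
    then have "u * r i \<le> ?u0 * r i" using r_pos[OF i] by simp
    with coord[OF i] show ?thesis by linarith
  qed
  then show ?thesis
    unfolding coverable_def by (intro exI[of _ "{S}"]) (simp add: oscillation_le_def)
qed

text \<open>At this radius the factor \<open>Q * u powr (- 2 * \<theta>)\<close> is exactly
  \<open>(4 powr \<theta>) ^ k\<close>, so the number of greedy steps per halving is governed by a
  geometric sequence.\<close>

lemma energy_growth_dyadic:
  assumes u: "u = Q powr (1 / (2 * \<theta>)) / 2 ^ k" "1 \<le> u"
    and xy: "x \<in> S" "y \<in> S" "\<And>i. i < m \<Longrightarrow> \<bar>a i \<bullet> (x - y)\<bar> \<le> u * r i"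
  shows "energy (x - y) \<le> u\<^sup>2 * (4 powr \<theta>) ^ k"
proof -
  have "u powr (2 * \<theta>) = Q / (4 powr \<theta>) ^ k"
    unfolding u(1) by (simp add: powr_divide initial_radius_powr two_power_powr)
  then have "Q * u powr (2 - 2 * \<theta>) = u\<^sup>2 * (4 powr \<theta>) ^ k"
    using u(2) Q by (simp add: powr_diff)
  with energy_growth[OF xy(1,2) u(2) xy(3)] show ?thesis by simp
qed

text \<open>Halving the oscillation from \<open>u\<close> to \<open>u / 2\<close> costs a factor with exponent of order
  \<open>Q * u powr (- 2 * \<theta>)\<close>. These exponents grow geometrically as \<open>u\<close> decreases, so their sum is
  dominated by the last one, where \<open>u\<close> is of order \<open>1\<close>.\<close>

lemma coverable_dyadic:
  assumes "2 ^ k \<le> Q powr (1 / (2 * \<theta>))"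
  shows "\<exists>e. coverable S ((2 * m + 1) ^ e) (Q powr (1 / (2 * \<theta>)) / 2 ^ k) \<and>
    real e \<le> 17 / (4 powr \<theta> - 1) * (4 powr \<theta>) ^ k"
  using assms
proof (induction k)
  case 0
  have "(1::real) < 4 powr \<theta>" using \<theta> by simp
  then show ?case using coverable_initial by (intro exI[of _ 0]) simp
next
  case (Suc k)
  define u where "u = Q powr (1 / (2 * \<theta>)) / 2 ^ k"
  define q where "q = (4::real) powr \<theta>"
  have q: "1 < q" using \<theta> by (simp add: q_def)
  then have qk: "1 \<le> q ^ k" by simp
  have u2: "2 \<le> u" using Suc.prems by (simp add: u_def field_simps)
  have "(2::real) ^ k \<le> 2 ^ Suc k" by simp
  with Suc.prems have "2 ^ k \<le> Q powr (1 / (2 * \<theta>))" by linarith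
  from Suc.IH[OF this] obtain e where e: "coverable S ((2 * m + 1) ^ e) u" "real e \<le> 17 / (q - 1) * q ^ k"
    unfolding u_def q_def by blast
  \<comment> \<open>Halving uses greedy accuracy u / 4, so d must be at least
    \<open>16 * q ^ k\<close>. Rounding up adds at most 1, hence at most \<open>q ^ k\<close>, which
    explains the 17.\<close>
  define d where "d = nat \<lceil>16 * q ^ k\<rceil>"
  have d: "16 * q ^ k \<le> real d" "real d \<le> 17 * q ^ k" using qk by (auto simp: d_def) linarith+
  have "coverable S ((2 * m + 1) ^ e * (2 * m + 1) ^ d) (2 * (u / 4))"
  proof (rule coverable_refine[OF S e(1)])
    fix x y assume xy: "x \<in> S" "y \<in> S" "\<And>i. i < m \<Longrightarrow> \<bar>a i \<bullet> (x - y)\<bar> \<le> u * r i"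
    have "energy (x - y) \<le> u\<^sup>2 * q ^ k"
      unfolding q_def using u2 by (intro energy_growth_dyadic[OF u_def _ xy]) auto
    also have "\<dots> = (16 * q ^ k) * (u / 4)\<^sup>2" by (simp add: power2_eq_square)
    also have "\<dots> \<le> real d * (u / 4)\<^sup>2" using d(1) by (intro mult_right_mono) auto
    finally show "energy (x - y) \<le> real d * (u / 4)\<^sup>2" .
  qed (use u2 in simp)
  moreover have "2 * (u / 4) = Q powr (1 / (2 * \<theta>)) / 2 ^ Suc k" by (simp add: u_def)
  moreover have "real (e + d) \<le> 17 / (q - 1) * q ^ Suc k"
  proof -
    have "real (e + d) \<le> 17 / (q - 1) * q ^ k + 17 * q ^ k" using e(2) d(2) by simp
    \<comment> \<open>The constant \<open>17 / (q - 1)\<close> is the one for which adding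
      \<open>17 * q ^ k\<close> multiplies the bound by exactly \<open>q\<close>.\<close>
    also have "\<dots> = 17 / (q - 1) * q ^ Suc k" using q by (simp add: field_simps)
    finally show ?thesis .
  qed
  ultimately show ?case unfolding q_def power_add[symmetric] by metis
qed

text \<open>The radius is halved until it lies between 1 and 2, since the growth estimate requires
  radius at least 1. A single further refinement then goes straight down to \<rho>.\<close>

lemma coverable_small:
  assumes \<rho>: "0 < \<rho>"
  shows "\<exists>e. coverable S ((2 * m + 1) ^ e) \<rho> \<and>
    real e \<le> (17 / (4 powr \<theta> - 1) + 16 / \<rho>\<^sup>2 + 1) * Q"
proof -
  define u0 where "u0 = Q powr (1 / (2 * \<theta>))"
  define q where "q = (4::real) powr \<theta>"
  have q: "1 < q" using \<theta> by (simp add: q_def)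
  have u0: "1 \<le> u0" unfolding u0_def by (rule initial_radius_ge_1)
  obtain N where "u0 < 2 ^ N" using real_arch_pow[of 2 u0] by auto
  also have "(2::real) ^ N \<le> 2 ^ Suc N" by simp
  finally have "u0 < 2 ^ Suc N" .
  define k where "k = (LEAST N. u0 < 2 ^ Suc N)"
  have "u0 < 2 ^ Suc k" unfolding k_def by (rule LeastI[of "\<lambda>N. u0 < 2 ^ Suc N", OF \<open>u0 < 2 ^ Suc N\<close>])
  have k: "2 ^ k \<le> u0"
  proof (cases k)
    case (Suc k')
    then show ?thesis using not_less_Least[of k' "\<lambda>N. u0 < 2 ^ Suc N"] by (auto simp: k_def)
  qed (use u0 in simp)
  define u where "u = u0 / 2 ^ k"
  have u: "1 \<le> u" "u \<le> 2" using k \<open>u0 < 2 ^ Suc k\<close> by (auto simp: u_def field_simps)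
  obtain e where e: "coverable S ((2 * m + 1) ^ e) u" "real e \<le> 17 / (q - 1) * q ^ k"
    using coverable_dyadic[of k] k unfolding u_def u0_def q_def by blast
  have "(2 ^ k) powr (2 * \<theta>) \<le> u0 powr (2 * \<theta>)" using k \<theta> by (intro powr_mono2) auto
  \<comment> \<open>Raising \<open>2 ^ k \<le> u0\<close> to the power 2\<theta> bounds the last,
    dominant exponent by a multiple of \<open>Q\<close>.\<close>
  then have qk: "q ^ k \<le> Q" by (simp add: u0_def initial_radius_powr two_power_powr q_def)
  \<comment> \<open>With radius at most 2 the energy is at most 4Q, and the greedy accuracy is
    \<rho> / 2.\<close>
  define d where "d = nat \<lceil>16 * Q / \<rho>\<^sup>2\<rceil>"
  have "0 \<le> 16 * Q / \<rho>\<^sup>2" using Q by simp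
  then have d: "16 * Q / \<rho>\<^sup>2 \<le> real d" "real d \<le> 16 * Q / \<rho>\<^sup>2 + 1" unfolding d_def by linarith+
  have "coverable S ((2 * m + 1) ^ e * (2 * m + 1) ^ d) (2 * (\<rho> / 2))"
  proof (rule coverable_refine[OF S e(1)])
    fix x y assume xy: "x \<in> S" "y \<in> S" "\<And>i. i < m \<Longrightarrow> \<bar>a i \<bullet> (x - y)\<bar> \<le> u * r i"
    have "energy (x - y) \<le> u\<^sup>2 * q ^ k"
      unfolding q_def by (rule energy_growth_dyadic[OF _ u(1) xy]) (simp add: u_def u0_def)
    also have "\<dots> \<le> 2\<^sup>2 * Q" using u qk q by (intro mult_mono power_mono) auto
    also have "\<dots> = 16 * Q / \<rho>\<^sup>2 * (\<rho> / 2)\<^sup>2" using \<rho> by (simp add: power2_eq_square)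
    also have "\<dots> \<le> real d * (\<rho> / 2)\<^sup>2" using d(1) by (intro mult_right_mono) auto
    finally show "energy (x - y) \<le> real d * (\<rho> / 2)\<^sup>2" .
  qed (use \<rho> in simp)
  moreover have "real (e + d) \<le> (17 / (q - 1) + 16 / \<rho>\<^sup>2 + 1) * Q"
  proof -
    have "17 / (q - 1) * q ^ k \<le> 17 / (q - 1) * Q" using q qk by (intro mult_left_mono) auto
    then have "real (e + d) \<le> 17 / (q - 1) * Q + 16 * Q / \<rho>\<^sup>2 + Q" using e(2) d(2) Q by simp
    then show ?thesis by (simp add: algebra_simps)
  qed
  moreover have "2 * (\<rho> / 2) = \<rho>" by simp
  ultimately show ?thesis unfolding q_def power_add[symmetric] by metis
qed

end

end

section \<open>The covering number of the ball\<close>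

text \<open>A member of each piece serves as the centre of a translate. Empty pieces are discarded,
  as the choice of a member says nothing there.\<close>

lemma (in dual_vectors) covering_number_le:
  assumes S: "S \<subseteq> carrier_vec n" and cov: "coverable S N u"
    and K: "\<And>z. z \<in> carrier_vec n \<Longrightarrow> (\<And>i. i < m \<Longrightarrow> \<bar>a i \<bullet> z\<bar> \<le> u * r i) \<Longrightarrow> z \<in> K"
  shows "covering_number n S K \<le> enat N"
proof -
  obtain \<A> where \<A>: "finite \<A>" "card \<A> \<le> N" "S \<subseteq> \<Union>\<A>"
    and \<A>': "\<And>A. A \<in> \<A> \<Longrightarrow> A \<subseteq> S" "\<And>A. A \<in> \<A> \<Longrightarrow> oscillation_le u A"
    using cov unfolding coverable_def by blast
  define base where "base A = (SOME y. y \<in> A)" for A :: "real vec set"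
  have base: "base A \<in> A" if "x \<in> A" for x A
    unfolding base_def using that by (rule someI)
  define T where "T = base ` {A \<in> \<A>. A \<noteq> {}}"
  have "finite T" using \<A>(1) by (simp add: T_def)
  moreover have "T \<subseteq> carrier_vec n"
    using base \<A>'(1) S unfolding T_def by fast
  moreover have "S \<subseteq> (\<Union>t\<in>T. (\<lambda>y. t + y) ` K)"
  proof
    fix x assume "x \<in> S"
    then obtain A where A: "A \<in> \<A>" "x \<in> A" using \<A>(3) by blast
    then have b: "base A \<in> A" "base A \<in> T" using base by (auto simp: T_def)
    have car: "x \<in> carrier_vec n" "base A \<in> carrier_vec n"
      using A(2) b(1) \<A>'(1)[OF A(1)] S by auto
    have "x - base A \<in> K"
      using car A(2) b(1) \<A>'(2)[OF A(1)] by (intro K) (auto simp: oscillation_le_def)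
    moreover have "x = base A + (x - base A)"
      using car by (intro eq_vecI) auto
    ultimately show "x \<in> (\<Union>t\<in>T. (\<lambda>y. t + y) ` K)" using b(2) by blast
  qed
  ultimately have "covering_number n S K \<le> enat (card T)"
    unfolding covering_number_def by (intro Inf_lower) blast
  also have "card T \<le> card {A \<in> \<A>. A \<noteq> {}}"
    unfolding T_def using \<A>(1) by (intro card_image_le) simp
  also have "\<dots> \<le> card \<A>" using \<A>(1) by (intro card_mono) auto
  also have "\<dots> \<le> N" by (rule \<A>(2))
  finally show ?thesis by simp
qed

section \<open>Growth and decay of a single function under (H1) to (H5)\<close>

context
  fixes L C \<theta> c :: real and h :: "real \<Rightarrow> real"
  assumes \<theta>: "0 < \<theta>" and c: "0 < c" and H: "H_conditions L C \<theta> c h"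
begin

lemma H_nonneg: "0 \<le> h x"
  using H by (simp add: H_conditions_def)

text \<open>The double sign in (H3) absorbs the sign of \<open>x\<close>; the same happens for (H4)
  below.\<close>

lemma H_scale_upper: "1 \<le> t \<Longrightarrow> h (t * \<bar>x\<bar>) \<le> C * t * h x"
  using H unfolding H_conditions_def by (cases "0 \<le> x") (metis abs_of_nonneg, metis abs_of_neg not_le minus_minus)

lemma H_scale_lower: "1 \<le> t \<Longrightarrow> c * t powr \<theta> * h x \<le> h (t * \<bar>x\<bar>)"
  using H unfolding H_conditions_def by (cases "0 \<le> x") (metis abs_of_nonneg, metis abs_of_neg not_le minus_minus)

text \<open>By (H4) at 0, \<open>h 0\<close> dominates \<open>c * t powr \<theta> * h 0\<close> for
  all t \<ge> 1, and \<open>t\<close> can be taken so large that the factor is at least 2.\<close>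

lemma H_zero: "h 0 = 0"
proof -
  define t where "t = max 1 ((2 / c) powr (1 / \<theta>))"
  have "2 / c = ((2 / c) powr (1 / \<theta>)) powr \<theta>" using \<theta> c by (simp add: powr_powr)
  also have "\<dots> \<le> t powr \<theta>" using \<theta> by (intro powr_mono2) (auto simp: t_def)
  finally have "2 \<le> c * t powr \<theta>" using c by (simp add: field_simps)
  then have "2 * h 0 \<le> c * t powr \<theta> * h 0" using H_nonneg by (intro mult_right_mono)
  also have "\<dots> \<le> h 0" using H_scale_lower[of t 0] by (simp add: t_def)
  finally show ?thesis using H_nonneg[of 0] by linarith
qed

lemma H_diff_square_le: "(h (x - y))\<^sup>2 \<le> 2 * L\<^sup>2 * ((h x)\<^sup>2 + (h y)\<^sup>2)"
proof -
  have "h (x - y) \<le> L * (h x + h y)" using H by (simp add: H_conditions_def)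
  then have "(h (x - y))\<^sup>2 \<le> (L * (h x + h y))\<^sup>2" using H_nonneg by (intro power_mono)
  also have "\<dots> = L\<^sup>2 * (h x + h y)\<^sup>2" by (rule power_mult_distrib)
  also have "\<dots> \<le> L\<^sup>2 * (2 * ((h x)\<^sup>2 + (h y)\<^sup>2))"
    using sum_squares_bound[of "h x" "h y"] by (intro mult_left_mono) (auto simp: power2_sum)
  finally show ?thesis by (simp only: mult_ac)
qed

text \<open>(H4) with the scaling factor \<open>r / \<bar>t\<bar>\<close>, which is at least 1 /
  \<rho>. For \<open>t = 0\<close> there is no such factor and \<open>H_zero\<close> takes
  over.\<close>

lemma H_decay:
  assumes "0 < r" "0 < \<rho>" "\<rho> \<le> 1" "\<bar>t\<bar> \<le> \<rho> * r"
  shows "c * h t \<le> \<rho> powr \<theta> * h r"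
proof (cases "t = 0")
  case True
  then show ?thesis using H_zero H_nonneg by simp
next
  case False
  define s where "s = r / \<bar>t\<bar>"
  have "\<rho> * r \<le> r" using assms by simp
  with assms(4) have "\<bar>t\<bar> \<le> r" by linarith
  then have s: "1 \<le> s" using False by (simp add: s_def)
  have "1 / \<rho> \<le> s" using assms False by (simp add: s_def field_simps)
  then have "(1 / \<rho>) powr \<theta> \<le> s powr \<theta>" using assms \<theta> by (intro powr_mono2) auto
  then have "1 \<le> \<rho> powr \<theta> * s powr \<theta>" using assms by (simp add: powr_divide field_simps)
  then have "c * h t * 1 \<le> c * h t * (\<rho> powr \<theta> * s powr \<theta>)"
    using c H_nonneg by (intro mult_left_mono) auto
  also have "\<dots> = \<rho> powr \<theta> * (c * s powr \<theta> * h t)" by simp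
  also have "\<dots> \<le> \<rho> powr \<theta> * h (s * \<bar>t\<bar>)" by (intro mult_left_mono H_scale_lower s) auto
  finally show ?thesis using False by (simp add: s_def)
qed

text \<open>Compares both sides with \<open>h (u * r)\<close>: (H4) bounds it from below starting at
  \<open>r\<close>, and (H3) from above starting at \<open>t\<close>.\<close>

lemma H_growth:
  assumes r: "0 < r" and u: "1 \<le> u" and t: "\<bar>t\<bar> \<le> u * r"
  shows "c * u powr \<theta> * h r * \<bar>t\<bar> \<le> C * u * r * h t"
proof (cases "t = 0")
  case True
  then show ?thesis using H_zero by simp
next
  case False
  have "c * u powr \<theta> * h r \<le> h (u * r)" using H_scale_lower[OF u, of r] r by simp
  also have "\<dots> = h (u * r / \<bar>t\<bar> * \<bar>t\<bar>)" using False by simp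
  also have "\<dots> \<le> C * (u * r / \<bar>t\<bar>) * h t" using False t by (intro H_scale_upper) simp
  finally show ?thesis using False by (simp add: field_simps)
qed

text \<open>The weight bound trades \<open>s * w * r\<^sup>2\<close> for
  \<open>\<alpha> * (h r)\<^sup>2\<close>, to which the square of \<open>H_growth\<close> applies.
  In the exponent, 2 comes from (H3) and -2\<theta> from (H4).\<close>

lemma weighted_square_le:
  assumes r: "0 < r" and u: "1 \<le> u" and t: "\<bar>t\<bar> \<le> u * r" and pos: "0 < w" "0 < s" "0 < \<alpha>"
    and lower: "s / \<alpha> \<le> (h r)\<^sup>2 / (w * r\<^sup>2)"
  shows "w * t\<^sup>2 \<le> C\<^sup>2 * \<alpha> / c\<^sup>2 / s * u powr (2 - 2 * \<theta>) * (h t)\<^sup>2"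
proof -
  have u2: "(u powr \<theta>)\<^sup>2 = u powr (2 * \<theta>)" using u by (simp add: powr_power mult.commute)
  have "s * w * r\<^sup>2 \<le> \<alpha> * (h r)\<^sup>2" using lower pos r by (simp add: field_simps)
  then have "(c\<^sup>2 * u powr (2 * \<theta>) * t\<^sup>2) * (s * w * r\<^sup>2) \<le> (c\<^sup>2 * u powr (2 * \<theta>) * t\<^sup>2) * (\<alpha> * (h r)\<^sup>2)"
    by (intro mult_left_mono) auto
  also have "\<dots> = \<alpha> * (c * u powr \<theta> * h r * \<bar>t\<bar>)\<^sup>2"
    by (simp add: power_mult_distrib u2)
  also have "\<dots> \<le> \<alpha> * (C * u * r * h t)\<^sup>2"
    using pos c H_nonneg by (intro mult_left_mono power_mono H_growth r u t mult_nonneg_nonneg) auto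
  also have "\<dots> = (\<alpha> * C\<^sup>2 * u\<^sup>2 * (h t)\<^sup>2) * r\<^sup>2" by (simp add: power_mult_distrib)
  finally have "c\<^sup>2 * u powr (2 * \<theta>) * t\<^sup>2 * s * w * r\<^sup>2 \<le> \<alpha> * C\<^sup>2 * u\<^sup>2 * (h t)\<^sup>2 * r\<^sup>2"
    by (simp add: mult_ac)
  then have "c\<^sup>2 * u powr (2 * \<theta>) * t\<^sup>2 * s * w \<le> \<alpha> * C\<^sup>2 * u\<^sup>2 * (h t)\<^sup>2"
    using r by simp
  then show ?thesis using pos c u by (simp add: powr_diff field_simps)
qed

end

section \<open>From approximate weights to the covering bound\<close>

lemma approx_weight_dual_vectors:
  assumes a: "\<And>i. i < m \<Longrightarrow> a i \<in> carrier_vec n" and s: "0 < s" "0 < \<alpha>"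
    and aw: "approx_weight n m f a \<alpha> s w"
  defines "r \<equiv> \<lambda>i. l2_norm (inv_mat (sqrt_mat (weight_mat n m a w)) *\<^sub>v a i)"
  shows "\<exists>p. dual_vectors n m a w r p"
proof -
  let ?M = "weight_mat n m a w"
  have w: "0 < w i" if "i < m" for i using aw that by (simp add: approx_weight_def)
  have lower: "s / \<alpha> \<le> f i (r i) / (w i * (r i)\<^sup>2)" if "i < m" for i
    using aw that by (simp add: approx_weight_def r_def Let_def)
  interpret pos_def_mat ?M n
    using aw w by (intro weight_mat_pos_def a) (auto simp: approx_weight_def less_imp_le)
  have "\<exists>p. p \<in> carrier_vec n \<and> ?M *\<^sub>v p = a i \<and> a i \<bullet> p = (r i)\<^sup>2" if "i < m" for i
    using inv_sqrt_mat_whitening[OF a[OF that]] unfolding r_def by blast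
  then obtain p where p: "\<And>i. i < m \<Longrightarrow> p i \<in> carrier_vec n \<and> ?M *\<^sub>v p i = a i \<and> a i \<bullet> p i = (r i)\<^sup>2"
    by metis
  have "dual_vectors n m a w r p"
  proof
    fix i assume i: "i < m"
    show "a i \<in> carrier_vec n" "0 < w i" "p i \<in> carrier_vec n" "a i \<bullet> p i = (r i)\<^sup>2"
      using a w p i by auto
    (* For r i = 0 the quotient in the definition of an approximate weight would be x / 0 = 0. *)
    have "r i \<noteq> 0"
      using lower[OF i] s by (auto simp: divide_le_0_iff)
    moreover have "0 \<le> r i" by (simp add: r_def l2_norm_def real_scalar_prod_self_ge_0)
    ultimately show "0 < r i" by simp
    fix x :: "real vec" assume x: "x \<in> carrier_vec n"
    show "(\<Sum>j<m. w j * (a j \<bullet> x) * (a j \<bullet> p i)) = a i \<bullet> x"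
      using weight_mat_bilinear[where a = a and m = m and w = w and y = "p i", OF a x] p[OF i] comm_scalar_prod[OF x a[OF i]] by simp
  qed
  then show ?thesis by blast
qed

text \<open>The choice of \<rho> makes \<open>\<rho> powr \<theta>\<close> equal to c / sqrt
  \<alpha>: the factor c cancels the loss in \<open>H_decay\<close>, and after squaring 1 / \<alpha>
  compensates the upper weight bound, so small coordinates imply membership in
  \<open>K_set\<close>.\<close>

lemma covering_number_bound:
  fixes L C \<theta> c \<alpha> :: real and j l :: int
  assumes const: "1 \<le> L" "1 \<le> C" "0 < \<theta>" "0 < c" "c < 1" "1 \<le> \<alpha>"
    and a: "\<And>i. i < m \<Longrightarrow> a i \<in> carrier_vec n"
    and H: "\<And>i. i < m \<Longrightarrow> H_conditions L C \<theta> c (h i)"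
    and aw: "approx_weight n m (\<lambda>i x. (h i x)\<^sup>2) a \<alpha> (2 powi j) (w j)" and jl: "j \<le> l"
  defines "\<rho> \<equiv> (c / sqrt \<alpha>) powr (1 / \<theta>)"
  shows "\<exists>e. covering_number n (B_set n (F_sum m h a) (2 powi l)) (K_set n m h a w j) \<le> enat ((2 * m + 1) ^ e) \<and>
    real e \<le> (17 / (4 powr \<theta> - 1) + 16 / \<rho>\<^sup>2 + 1) * (4 * L\<^sup>2 * C\<^sup>2 * \<alpha> / c\<^sup>2 * 2 powi (l - j))"
proof -
  define r where "r = (\<lambda>i. l2_norm (inv_mat (sqrt_mat (weight_mat n m a (w j))) *\<^sub>v a i))"
  obtain p where "dual_vectors n m a (w j) r p"
    using approx_weight_dual_vectors[OF a _ _ aw] const unfolding r_def by auto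
  then interpret dual_vectors n m a "w j" r p .
  have aw_lower: "2 powi j / \<alpha> \<le> (h i (r i))\<^sup>2 / (w j i * (r i)\<^sup>2)"
    and aw_upper: "(h i (r i))\<^sup>2 / (w j i * (r i)\<^sup>2) \<le> \<alpha> * 2 powi j" if "i < m" for i
    using aw that by (simp_all add: approx_weight_def r_def Let_def)
  define S where "S = B_set n (F_sum m h a) (2 powi l)"
  define K0 where "K0 = C\<^sup>2 * \<alpha> / c\<^sup>2"
  \<comment> \<open>Besides \<open>K0\<close> from \<open>weighted_square_le\<close>, the factor 4
    arises as 2 from squaring (H5) times 2 for the two points of the ball.\<close>
  define Q where "Q = 4 * L\<^sup>2 * C\<^sup>2 * \<alpha> / c\<^sup>2 * 2 powi (l - j)"
  have S: "S \<subseteq> carrier_vec n" by (auto simp: S_def B_set_def)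
  have Q: "Q = K0 / 2 powi j * (4 * L\<^sup>2 * 2 powi l)"
    by (simp add: Q_def K0_def power_int_diff)
  have "1 \<le> C\<^sup>2" "1 \<le> L\<^sup>2" "c\<^sup>2 \<le> 1" "0 < c\<^sup>2"
    using const by (auto simp: power_le_one)
  then have "1 \<le> C\<^sup>2 * \<alpha>" "1 \<le> 1 / c\<^sup>2" using const mult_mono[of 1 "C\<^sup>2" 1 \<alpha>] by auto
  then have "1 \<le> K0" unfolding K0_def using mult_mono[of 1 "C\<^sup>2 * \<alpha>" 1 "1 / c\<^sup>2"] by simp
  moreover have "1 \<le> (2::real) powi (l - j)" using jl by (intro one_le_power_int) auto
  moreover have "1 \<le> 4 * L\<^sup>2" using \<open>1 \<le> L\<^sup>2\<close> by simp
  ultimately have "1 * (1 * 1) \<le> K0 * (4 * L\<^sup>2 * 2 powi (l - j))" by (intro mult_mono) auto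
  then have Q1: "1 \<le> Q" by (simp add: Q_def K0_def mult_ac)
  have "energy (x - y) \<le> Q * u powr (2 - 2 * \<theta>)"
    if xy: "x \<in> S" "y \<in> S" and u: "1 \<le> u" and close: "\<And>i. i < m \<Longrightarrow> \<bar>a i \<bullet> (x - y)\<bar> \<le> u * r i" for x y u
  proof -
    have car: "x \<in> carrier_vec n" "y \<in> carrier_vec n" using xy S by auto
    let ?b = "K0 / 2 powi j * u powr (2 - 2 * \<theta>)"
    have b: "0 \<le> ?b" using const by (simp add: K0_def)
    have "energy (x - y) \<le> (\<Sum>i<m. ?b * (h i (a i \<bullet> (x - y)))\<^sup>2)"
      unfolding energy_def K0_def
      by (intro sum_mono weighted_square_le[OF const(3,4) H r_pos u close w_pos _ _ aw_lower]) (use const in auto)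
    also have "\<dots> \<le> (\<Sum>i<m. ?b * (2 * L\<^sup>2 * ((h i (a i \<bullet> x))\<^sup>2 + (h i (a i \<bullet> y))\<^sup>2)))"
    proof (intro sum_mono mult_left_mono b)
      fix i assume "i \<in> {..<m}"
      then show "(h i (a i \<bullet> (x - y)))\<^sup>2 \<le> 2 * L\<^sup>2 * ((h i (a i \<bullet> x))\<^sup>2 + (h i (a i \<bullet> y))\<^sup>2)"
        using H_diff_square_le[OF const(3,4) H, of i "a i \<bullet> x" "a i \<bullet> y"] car
        by (simp add: scalar_prod_minus_distrib[of _ n])
    qed
    also have "\<dots> = ?b * (2 * L\<^sup>2 * (F_sum m h a x + F_sum m h a y))"
      by (simp only: F_sum_def sum.distrib sum_distrib_left[symmetric])
    also have "\<dots> \<le> ?b * (2 * L\<^sup>2 * (2 powi l + 2 powi l))"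
      using xy by (intro mult_left_mono add_mono b) (auto simp: S_def B_set_def)
    also have "\<dots> = Q * u powr (2 - 2 * \<theta>)" by (simp add: Q)
    finally show ?thesis .
  qed
  moreover have \<rho>: "0 < \<rho>" using const by (simp add: \<rho>_def)
  ultimately obtain e where e: "coverable S ((2 * m + 1) ^ e) \<rho>"
      "real e \<le> (17 / (4 powr \<theta> - 1) + 16 / \<rho>\<^sup>2 + 1) * Q"
    using coverable_small[OF S Q1 const(3)] by blast
  have "1 \<le> sqrt \<alpha>" using const by simp
  then have "c \<le> sqrt \<alpha>" using const by linarith
  then have "\<rho> \<le> 1 powr (1 / \<theta>)"
    unfolding \<rho>_def using const by (intro powr_mono2) auto
  then have \<rho>1: "\<rho> \<le> 1" by simp
  have in_K: "z \<in> K_set n m h a w j"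
    if z: "z \<in> carrier_vec n" and small: "\<And>i. i < m \<Longrightarrow> \<bar>a i \<bullet> z\<bar> \<le> \<rho> * r i" for z
  proof -
    have "(h i (a i \<bullet> z))\<^sup>2 \<le> 2 powi j * w j i * (r i)\<^sup>2" if i: "i < m" for i
    proof -
      have "c * h i (a i \<bullet> z) \<le> \<rho> powr \<theta> * h i (r i)"
        by (rule H_decay[OF const(3,4) H[OF i] r_pos[OF i] \<rho> \<rho>1 small[OF i]])
      also have "\<rho> powr \<theta> = c / sqrt \<alpha>" using const by (simp add: \<rho>_def powr_powr)
      finally have "h i (a i \<bullet> z) \<le> h i (r i) / sqrt \<alpha>" using const by (simp add: field_simps)
      then have "(h i (a i \<bullet> z))\<^sup>2 \<le> (h i (r i) / sqrt \<alpha>)\<^sup>2"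
        using H_nonneg[OF const(3,4) H[OF i]] by (intro power_mono)
      also have "\<dots> = (h i (r i))\<^sup>2 / \<alpha>" using const by (simp add: power_divide)
      also have "\<dots> \<le> 2 powi j * w j i * (r i)\<^sup>2"
        using aw_upper[OF i] const w_pos[OF i] r_pos[OF i] by (simp add: field_simps)
      finally show ?thesis .
    qed
    then show ?thesis using z by (simp add: K_set_def Let_def r_def)
  qed
  have "covering_number n S (K_set n m h a w j) \<le> enat ((2 * m + 1) ^ e)"
    by (rule covering_number_le[OF S e(1) in_K])
  then show ?thesis using e(2) unfolding S_def Q_def by blast
qed

theorem theorem3p2:
  fixes L C \<theta> c \<alpha> :: real
  assumes "1 \<le> L" and "1 \<le> C" and "0 < \<theta>" and "0 < c" and "c < 1" and "1 \<le> \<alpha>"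
  shows "\<exists>Chat::real.
    \<forall>(n::nat) (m::nat) (a::nat \<Rightarrow> real Matrix.vec) (h::nat \<Rightarrow> real \<Rightarrow> real)
      (J::int set) (jmax::int) (w::int \<Rightarrow> nat \<Rightarrow> real).
      2 \<le> m \<longrightarrow>
      (\<forall>i<m. a i \<in> carrier_vec n \<and> a i \<noteq> 0\<^sub>v n) \<longrightarrow>
      spans n (a ` {..<m}) \<longrightarrow>
      (\<forall>i<m. H_conditions L C \<theta> c (h i)) \<longrightarrow>
      (\<forall>i\<in>J. \<forall>k\<in>J. {i..k} \<subseteq> J) \<longrightarrow>
      jmax \<in> J \<longrightarrow> (\<forall>j\<in>J. j \<le> jmax) \<longrightarrow>
      approx_weight_scheme n m (\<lambda>i x. (h i x)\<^sup>2) a \<alpha> J w \<longrightarrow>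
      (let l = jmax + 1 in
        \<forall>j\<in>J. let N = covering_number n (B_set n (F_sum m h a) (2 powi l)) (K_set n m h a w j)
          in N \<noteq> \<infinity> \<and> ln (real (the_enat N)) \<le> Chat * 2 powi (l - j) * ln (real m))"
proof -
  define \<rho> where "\<rho> = (c / sqrt \<alpha>) powr (1 / \<theta>)"
  define D where "D = (17 / (4 powr \<theta> - 1) + 16 / \<rho>\<^sup>2 + 1) * (4 * L\<^sup>2 * C\<^sup>2 * \<alpha> / c\<^sup>2)"
  have "N \<noteq> \<infinity> \<and> ln (real (the_enat N)) \<le> 3 * D * 2 powi (jmax + 1 - j) * ln (real m)"
    if m: "2 \<le> m" and a: "\<forall>i<m. a i \<in> carrier_vec n \<and> a i \<noteq> 0\<^sub>v n"
      and H: "\<forall>i<m. H_conditions L C \<theta> c (h i)"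
      and J: "\<forall>j\<in>J. j \<le> jmax" and j: "j \<in> J"
      and scheme: "approx_weight_scheme n m (\<lambda>i x. (h i x)\<^sup>2) a \<alpha> J w"
      and N: "N = covering_number n (B_set n (F_sum m h a) (2 powi (jmax + 1))) (K_set n m h a w j)"
    for n m :: nat and a h J jmax w j N
  proof -
    let ?B = "D * 2 powi (jmax + 1 - j)"
    have aw: "approx_weight n m (\<lambda>i x. (h i x)\<^sup>2) a \<alpha> (2 powi j) (w j)"
      using scheme j by (simp add: approx_weight_scheme_def)
    have "j \<le> jmax + 1" using J j by force
    then obtain e where e: "N \<le> enat ((2 * m + 1) ^ e)" "real e \<le> ?B"
      using covering_number_bound[where h = h and w = w and j = j and l = "jmax + 1", OF assms _ _ aw] a H
      unfolding N D_def \<rho>_def by (auto simp: mult.assoc)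
    then obtain k where k: "N = enat k" "k \<le> (2 * m + 1) ^ e" by (cases N) auto
    have lnm: "0 \<le> ln (real m)" using m by simp
    have "ln (real k) \<le> real e * (3 * ln (real m))"
    proof (cases "k = 0")
      \<comment> \<open>By convention \<open>ln 0 = 0\<close>, so the bound is trivial here.\<close>
      case True
      then show ?thesis using lnm by simp
    next
      case False
      \<comment> \<open>Since m \<ge> 2, the base of the cover is at most the cube of m, which gives
        the factor 3 in the final constant.\<close>
      have "2 * m + 1 \<le> 2 * 2 * m" using m by linarith
      also have "\<dots> \<le> m * m * m" using m by (intro mult_le_mono) auto
      finally have "2 * m + 1 \<le> m ^ 3" by (simp add: power3_eq_cube)
      then have "(2 * m + 1) ^ e \<le> (m ^ 3) ^ e" by (rule power_mono) simp
      then have "real k \<le> real ((m ^ 3) ^ e)" using k(2) by linarith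
      then have "ln (real k) \<le> ln (real ((m ^ 3) ^ e))" using False by (intro ln_mono) auto
      also have "\<dots> = real e * (3 * ln (real m))" using m by (simp add: ln_realpow)
      finally show ?thesis .
    qed
    also have "\<dots> \<le> ?B * (3 * ln (real m))" using e(2) lnm by (intro mult_right_mono) auto
    finally show ?thesis using k(1) by (simp add: mult_ac)
  qed
  then show ?thesis unfolding Let_def by (intro exI[of _ "3 * D"] allI impI ballI) blast
qed

end
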